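(* Let $X$ be a compact metric space, $f:X\to X$ a continuous map, $\varphi:X\to\mathbb{R}$ a continuous function, and $\mu\in\mathcal{M}(X,f)$ an $f$-invariant Borel probability measure. For any ergodic decomposition $\tau$ of $\mu$, $$P_\mu(f,\varphi)=\operatorname{ess\,sup}\{P_\nu(f,\varphi):\nu\in\mathcal{E}(X,f)\}=\operatorname{ess\,sup}\Big\{h_\nu(f)+\int_X\varphi\,d\nu:\nu\in\mathcal{E}(X,f)\Big\},$$ where the essential suprema are taken with respect to $\tau$. Consequently, $$P_\mu(f,\varphi)\ge h_\mu(f)+\int_X\varphi\,d\mu .$$
   Context: Let $d$ be the metric on $X$. $\mathcal{M}(X,f)$ denotes the set of $f$-invariant Borel probability measures on $X$ (with the weak-star topology), and $\mathcal{E}(X,f)\subset\mathcal{M}(X,f)$ the ergodic ones. $h_\mu(f)$ is the Kolmogorov–Sinai entropy. A Borel probability measure $\tau$ on $\mathcal{M}(X,f)$ is an ergodic decomposition of $\mu\in\mathcal{M}(X,f)$ if $\tau(\mathcal{E}(X,f))=1$ and $\int_X\psi\,d\mu=\int_{\mathcal{E}(X,f)}\big(\int_X\psi\,d\nu\big)d\tau(\nu)$ for every $\psi\in L^1(\mu)$. Put $S_n\varphi(x)=\sum_{i=0}^{n-1}\varphi(f^ix)$, $d_n(x,y)=\max\{d(f^ix,f^iy):0\le i<n\}$ and $B_n(x,\epsilon)=\{y\in X:d_n(x,y)<\epsilon\}$. For $Z\subset X$, $\alpha\in\mathbb{R}$, $N\in\mathbb{N}$, $\epsilon>0$ let $$M(Z,\varphi,\alpha,N,\epsilon)=\inf\Big\{\sum_i\exp\big(-\alpha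 n_i+S_{n_i}\varphi(x_i)\big):\bigcup_iB_{n_i}(x_i,\epsilon)\supset Z,\ x_i\in X,\ n_i\ge N\text{ for all }i\Big\},$$ the infimum being over finite or countable families $(x_i,n_i)_i$. Let $m(Z,\varphi,\alpha,\epsilon)=\lim_{N\to\infty}M(Z,\varphi,\alpha,N,\epsilon)$ and $P_Z(f,\varphi,\epsilon)=\inf\{\alpha:m(Z,\varphi,\alpha,\epsilon)=0\}=\sup\{\alpha:m(Z,\varphi,\alpha,\epsilon)=+\infty\}$. For $\mu\in\mathcal{M}(X,f)$ let $P_\mu(f,\varphi,\epsilon)=\inf\{P_Z(f,\varphi,\epsilon):\mu(Z)=1\}$. The measure theoretic pressure is $P_\mu(f,\varphi)=\lim_{\epsilon\to0}P_\mu(f,\varphi,\epsilon)$. *)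

theory Defs
  imports "HOL-Probability.Probability"
begin

text \<open>
  The phase space is a whole type of class metric_space, assumed compact in the theorem;
  measures on it live on the Borel sets of the type.
\<close>

definition invariant_measures :: "('a::metric_space \<Rightarrow> 'a) \<Rightarrow> 'a measure set" where
  "invariant_measures f =
     {\<mu>. prob_space \<mu> \<and> sets \<mu> = sets borel \<and> distr \<mu> borel f = \<mu>}"

definition ergodic_measures :: "('a::metric_space \<Rightarrow> 'a) \<Rightarrow> 'a measure set" where
  "ergodic_measures f =
     {\<mu> \<in> invariant_measures f.
        \<forall>A \<in> sets borel. f -` A = A \<longrightarrow> measure \<mu> A = 0 \<or> measure \<mu> A = 1}"

text \<open>
  The coarsest topology on the invariant measures making integration against each continuous
  function continuous.  On a compact space continuous functions are bounded, hence integrable.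
\<close>

definition weak_star_topology :: "('a::metric_space \<Rightarrow> 'a) \<Rightarrow> 'a measure topology" where
  "weak_star_topology f =
     topology_generated_by
       {{\<nu> \<in> invariant_measures f. integral\<^sup>L \<nu> \<psi> \<in> U} |
          (\<psi> :: 'a \<Rightarrow> real) (U :: real set). continuous_on UNIV \<psi> \<and> open U}"

definition weak_star_borel :: "('a::metric_space \<Rightarrow> 'a) \<Rightarrow> 'a measure measure" where
  "weak_star_borel f = sigma (invariant_measures f) {U. openin (weak_star_topology f) U}"

text \<open>
  A non-measurable set has emeasure 0, so the condition that the ergodic measures have
  emeasure 1 includes their measurability.
\<close>

definition ergodic_decomposition ::
  "('a::metric_space \<Rightarrow> 'a) \<Rightarrow> 'a measure \<Rightarrow> 'a measure measure \<Rightarrow> bool" where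
  "ergodic_decomposition f \<mu> \<tau> \<longleftrightarrow>
     prob_space \<tau> \<and> sets \<tau> = sets (weak_star_borel f) \<and>
     emeasure \<tau> (ergodic_measures f) = 1 \<and>
     (\<forall>\<psi> :: 'a \<Rightarrow> real. integrable \<mu> \<psi> \<longrightarrow>
        integral\<^sup>L \<mu> \<psi> = (LINT \<nu>:ergodic_measures f|\<tau>. integral\<^sup>L \<nu> \<psi>))"

definition partition_entropy :: "'a measure \<Rightarrow> 'a set set \<Rightarrow> real" where
  "partition_entropy \<mu> P = - (\<Sum>A\<in>P. measure \<mu> A * ln (measure \<mu> A))"

text \<open>The common refinement of the pulled-back partitions for the iterates 0, ..., n - 1 of f.\<close>

definition dynamical_join :: "('a \<Rightarrow> 'a) \<Rightarrow> 'a set set \<Rightarrow> nat \<Rightarrow> 'a set set" where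
  "dynamical_join f P n =
     (\<lambda>A. \<Inter>i<n. (f ^^ i) -` A i) ` ({..<n} \<rightarrow>\<^sub>E P) - {{}}"

definition entropy_wrt :: "('a \<Rightarrow> 'a) \<Rightarrow> 'a measure \<Rightarrow> 'a set set \<Rightarrow> real" where
  "entropy_wrt f \<mu> P = lim (\<lambda>n. partition_entropy \<mu> (dynamical_join f P n) / real n)"

definition KS_entropy :: "('a \<Rightarrow> 'a) \<Rightarrow> 'a measure \<Rightarrow> ereal" where
  "KS_entropy f \<mu> =
     (SUP P \<in> {P. finite P \<and> P \<subseteq> sets \<mu> \<and> partition_on (space \<mu>) P}.
        ereal (entropy_wrt f \<mu> P))"

definition birkhoff_sum :: "('a \<Rightarrow> 'a) \<Rightarrow> ('a \<Rightarrow> real) \<Rightarrow> nat \<Rightarrow> 'a \<Rightarrow> real" where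
  "birkhoff_sum f \<phi> n x = (\<Sum>i<n. \<phi> ((f ^^ i) x))"

text \<open>
  Unspecified for n = 0 (maximum of the empty set); this can only enter the covering sums
  below when N = 0, which does not affect their limit in N.
\<close>

definition bowen_dist :: "('a::metric_space \<Rightarrow> 'a) \<Rightarrow> nat \<Rightarrow> 'a \<Rightarrow> 'a \<Rightarrow> real" where
  "bowen_dist f n x y = (MAX i\<in>{..<n}. dist ((f ^^ i) x) ((f ^^ i) y))"

definition bowen_ball :: "('a::metric_space \<Rightarrow> 'a) \<Rightarrow> nat \<Rightarrow> 'a \<Rightarrow> real \<Rightarrow> 'a set" where
  "bowen_ball f n x \<epsilon> = {y. bowen_dist f n x y < \<epsilon>}"

text \<open>Finite or countable families are indexed by arbitrary sets I of natural numbers.\<close>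

definition cover_sum ::
  "('a::metric_space \<Rightarrow> 'a) \<Rightarrow> ('a \<Rightarrow> real) \<Rightarrow> 'a set \<Rightarrow> real \<Rightarrow> nat \<Rightarrow> real \<Rightarrow> ennreal" where
  "cover_sum f \<phi> Z \<alpha> N \<epsilon> =
     Inf {(\<Sum>\<^sub>\<infinity>i\<in>I. ennreal (exp (- \<alpha> * real (n i) + birkhoff_sum f \<phi> (n i) (x i)))) |
            (I :: nat set) (n :: nat \<Rightarrow> nat) (x :: nat \<Rightarrow> 'a).
            Z \<subseteq> (\<Union>i\<in>I. bowen_ball f (n i) (x i) \<epsilon>) \<and> (\<forall>i\<in>I. N \<le> n i)}"

definition cover_limit ::
  "('a::metric_space \<Rightarrow> 'a) \<Rightarrow> ('a \<Rightarrow> real) \<Rightarrow> 'a set \<Rightarrow> real \<Rightarrow> real \<Rightarrow> ennreal" where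
  "cover_limit f \<phi> Z \<alpha> \<epsilon> = lim (\<lambda>N. cover_sum f \<phi> Z \<alpha> N \<epsilon>)"

definition set_pressure_at ::
  "('a::metric_space \<Rightarrow> 'a) \<Rightarrow> ('a \<Rightarrow> real) \<Rightarrow> 'a set \<Rightarrow> real \<Rightarrow> ereal" where
  "set_pressure_at f \<phi> Z \<epsilon> = Inf {ereal \<alpha> | \<alpha>. cover_limit f \<phi> Z \<alpha> \<epsilon> = 0}"

definition measure_pressure_at ::
  "('a::metric_space \<Rightarrow> 'a) \<Rightarrow> ('a \<Rightarrow> real) \<Rightarrow> 'a measure \<Rightarrow> real \<Rightarrow> ereal" where
  "measure_pressure_at f \<phi> \<mu> \<epsilon> =
     Inf {set_pressure_at f \<phi> Z \<epsilon> | Z. Z \<in> sets \<mu> \<and> emeasure \<mu> Z = 1}"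

definition measure_pressure ::
  "('a::metric_space \<Rightarrow> 'a) \<Rightarrow> ('a \<Rightarrow> real) \<Rightarrow> 'a measure \<Rightarrow> ereal" where
  "measure_pressure f \<phi> \<mu> = Lim (at_right 0) (\<lambda>\<epsilon>. measure_pressure_at f \<phi> \<mu> \<epsilon>)"

end

theory Submission
  imports Defs
begin

text \<open>
  Both bounds come from coding itineraries, with Gibbs' inequality as the only entropy estimate.

  Lower bound: if \<open>\<mu>(Z) = 1\<close> and \<open>Z\<close> has a cover by Bowen balls of total weight below
  one half, then almost every orbit can be parsed into these balls.  The resulting weights of words
  satisfy a Kraft inequality, and the expected code length per symbol is about
  \<open>\<alpha> - \<integral>\<phi> d\<mu>\<close>; hence \<open>h\<^sub>\<mu> + \<integral>\<phi> d\<mu> \<le> P\<^sub>\<mu>\<close> for every invariant measure, ergodic or not.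

  Upper bound: fix a partition into sets of small diameter and a threshold \<open>t\<close>.  The points whose
  itinerary is infinitely often compressed, by one of countably many integer-valued block codes,
  to a length rate plus average of \<open>\<phi>\<close> at most \<open>t\<close> form a Borel set of pressure at most \<open>t\<close>.  This one
  set has full measure for every ergodic \<open>\<nu>\<close> with \<open>h\<^sub>\<nu> + \<integral>\<phi> d\<nu> < t\<close>, by Shannon's code and the
  ergodic theorem, and therefore also for \<open>\<mu>\<close> when almost all ergodic components are of this kind.
\<close>

section \<open>Covers by Bowen balls\<close>

text \<open>Lower bound: the total one half leaves room for sending a symbol uncoded; ball codewords
  use mass at most 1/2 and the \<open>k\<close> symbols use \<open>1 / (2 k)\<close> each. The
  obstacle is that labels are not continuous, so a Bowen ball does not determine the itineraries of
  its points. Compact subsets of the cells, a positive distance apart, determine them except at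
  visits to a set of small measure, and those visits are paid for by a noise term at each symbol.

  Upper bound: the obstacle is uniformity, since sets of full measure chosen separately for each
  ergodic component say nothing about \<mu>. Integer lengths leave countably many codes, so the set
  is built without reference to a measure, and it is full for \<mu> exactly when it is full for
  almost every component. The same equivalence, applied to a countable minimising family of sets,
  bounds the essential supremum by the pressure of \<mu>. The essential suprema also require
  measurability in \<nu>, because \<open>esssup\<close> of a non-measurable function is
  \<open>top\<close>; for ergodic \<nu> the pressure is a supremum of countably many measurable
  functions.\<close>

lemma infsum_ennreal_nat:
  fixes g :: "nat \<Rightarrow> ennreal"
  shows "infsum g I = (\<Sum>i. if i \<in> I then g i else 0)"
proof (rule antisym)
  have "sum g F \<le> (\<Sum>i. if i \<in> I then g i else 0)" if "finite F" "F \<subseteq> I" for F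
  proof -
    have "sum g F = (\<Sum>i\<in>F. if i \<in> I then g i else 0)"
      using that by (intro sum.cong) auto
    also have "\<dots> \<le> (\<Sum>i. if i \<in> I then g i else 0)"
      using that by (intro sum_le_suminf) auto
    finally show ?thesis .
  qed
  then show "infsum g I \<le> (\<Sum>i. if i \<in> I then g i else 0)"
    by (subst nonneg_infsum_complete) (auto intro!: SUP_least)
next
  have "(\<Sum>i<n. if i \<in> I then g i else 0) \<le> infsum g I" for n
  proof -
    have "(\<Sum>i<n. if i \<in> I then g i else 0) = sum g ({..<n} \<inter> I)"
      by (simp add: sum.inter_restrict)
    also have "\<dots> \<le> infsum g I"
      by (subst nonneg_infsum_complete) (auto intro!: SUP_upper)
    finally show ?thesis .
  qed
  then show "(\<Sum>i. if i \<in> I then g i else 0) \<le> infsum g I"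
    by (simp add: suminf_eq_SUP SUP_le_iff)
qed

abbreviation ball_weight ::
  "('a::metric_space \<Rightarrow> 'a) \<Rightarrow> ('a \<Rightarrow> real) \<Rightarrow> real \<Rightarrow> nat \<Rightarrow> 'a \<Rightarrow> real" where
  "ball_weight f \<phi> \<alpha> n x \<equiv> exp (- \<alpha> * real n + birkhoff_sum f \<phi> n x)"

lemma cover_sum_le_infsum:
  fixes I :: "nat set"
  assumes "Z \<subseteq> (\<Union>i\<in>I. bowen_ball f (n i) (x i) \<epsilon>)" "\<And>i. i \<in> I \<Longrightarrow> N \<le> n i"
  shows "cover_sum f \<phi> Z \<alpha> N \<epsilon> \<le> (\<Sum>\<^sub>\<infinity>i\<in>I. ennreal (ball_weight f \<phi> \<alpha> (n i) (x i)))"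
  unfolding cover_sum_def using assms by (intro Inf_lower) blast

lemma cover_sum_lessE:
  assumes "cover_sum f \<phi> Z \<alpha> N \<epsilon> < c"
  obtains I :: "nat set" and n x where "Z \<subseteq> (\<Union>i\<in>I. bowen_ball f (n i) (x i) \<epsilon>)"
    "\<And>i. i \<in> I \<Longrightarrow> N \<le> n i" "(\<Sum>\<^sub>\<infinity>i\<in>I. ennreal (ball_weight f \<phi> \<alpha> (n i) (x i))) < c"
  using assms unfolding cover_sum_def Inf_less_iff by blast

text \<open>Covers built from itineraries are indexed by words, whereas \<open>cover_sum\<close>
  admits index sets of naturals; an enumeration of \<open>T\<close> bridges the two.\<close>

lemma cover_sum_le_finite:
  assumes "finite T" "Z \<subseteq> (\<Union>t\<in>T. bowen_ball f (n t) (x t) \<epsilon>)" "\<And>t. t \<in> T \<Longrightarrow> N \<le> n t"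
  shows "cover_sum f \<phi> Z \<alpha> N \<epsilon> \<le> ennreal (\<Sum>t\<in>T. ball_weight f \<phi> \<alpha> (n t) (x t))"
proof -
  obtain h where h: "bij_betw h {0..<card T} T"
    using ex_bij_betw_nat_finite[OF assms(1)] by blast
  have "cover_sum f \<phi> Z \<alpha> N \<epsilon> \<le>
      (\<Sum>\<^sub>\<infinity>i\<in>{0..<card T}. ennreal (ball_weight f \<phi> \<alpha> (n (h i)) (x (h i))))"
  proof (rule cover_sum_le_infsum)
    show "Z \<subseteq> (\<Union>i\<in>{0..<card T}. bowen_ball f (n (h i)) (x (h i)) \<epsilon>)"
    proof
      fix z assume "z \<in> Z"
      then obtain t where t: "t \<in> T" "z \<in> bowen_ball f (n t) (x t) \<epsilon>" using assms(2) by blast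
      then have "t \<in> h ` {0..<card T}" using bij_betw_imp_surj_on[OF h] by simp
      then obtain i where "i \<in> {0..<card T}" "t = h i" by (rule imageE)
      then show "z \<in> (\<Union>i\<in>{0..<card T}. bowen_ball f (n (h i)) (x (h i)) \<epsilon>)"
        using t by blast
    qed
  qed (use assms(3) bij_betwE[OF h] in auto)
  also have "\<dots> = (\<Sum>i\<in>{0..<card T}. ennreal (ball_weight f \<phi> \<alpha> (n (h i)) (x (h i))))"
    by simp
  also have "\<dots> = (\<Sum>t\<in>T. ennreal (ball_weight f \<phi> \<alpha> (n t) (x t)))"
    by (rule sum.reindex_bij_betw[OF h])
  also have "\<dots> = ennreal (\<Sum>t\<in>T. ball_weight f \<phi> \<alpha> (n t) (x t))"
    by (rule sum_ennreal) simp
  finally show ?thesis .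
qed

lemma cover_sum_mono:
  assumes "Z \<subseteq> Z'" "N \<le> N'" "\<alpha>' \<le> \<alpha>" "\<epsilon>' \<le> \<epsilon>"
  shows "cover_sum f \<phi> Z \<alpha> N \<epsilon> \<le> cover_sum f \<phi> Z' \<alpha>' N' \<epsilon>'"
  unfolding cover_sum_def[of f \<phi> Z' \<alpha>' N' \<epsilon>']
proof (rule Inf_greatest, safe)
  fix I :: "nat set" and n x
  assume Z: "Z' \<subseteq> (\<Union>i\<in>I. bowen_ball f (n i) (x i) \<epsilon>')" and n: "\<forall>i\<in>I. N' \<le> n i"
  have "cover_sum f \<phi> Z \<alpha> N \<epsilon> \<le> (\<Sum>\<^sub>\<infinity>i\<in>I. ennreal (ball_weight f \<phi> \<alpha> (n i) (x i)))"
  proof (rule cover_sum_le_infsum)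
    have "bowen_ball f (n i) (x i) \<epsilon>' \<subseteq> bowen_ball f (n i) (x i) \<epsilon>" for i
      using assms(4) by (auto simp: bowen_ball_def)
    then show "Z \<subseteq> (\<Union>i\<in>I. bowen_ball f (n i) (x i) \<epsilon>)"
      using Z assms(1) by blast
  qed (use n assms(2) in fastforce)
  also have "\<dots> \<le> (\<Sum>\<^sub>\<infinity>i\<in>I. ennreal (ball_weight f \<phi> \<alpha>' (n i) (x i)))"
    using assms(3)
    by (intro infsum_mono nonneg_summable_on_complete ennreal_leI) (auto intro: mult_right_mono)
  finally show "cover_sum f \<phi> Z \<alpha> N \<epsilon> \<le> (\<Sum>\<^sub>\<infinity>i\<in>I. ennreal (ball_weight f \<phi> \<alpha>' (n i) (x i)))" .
qed

text \<open>Near-optimal covers of the sets \<open>Z j\<close>, the j-th with error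
  \<open>e / 2^(j+1)\<close>, together cover the union; \<open>prod_decode\<close> flattens the
  doubly indexed family.\<close>

lemma cover_sum_UN:
  "cover_sum f \<phi> (\<Union>j::nat. Z j) \<alpha> N \<epsilon> \<le> (\<Sum>j. cover_sum f \<phi> (Z j) \<alpha> N \<epsilon>)"
proof (rule ennreal_le_epsilon)
  fix e :: real
  assume fin: "(\<Sum>j. cover_sum f \<phi> (Z j) \<alpha> N \<epsilon>) < top" and e: "0 < e"
  let ?c = "\<lambda>j. cover_sum f \<phi> (Z j) \<alpha> N \<epsilon>"
  have fin': "?c j < top" for j
    using ennreal_suminf_lessD[OF fin] .
  define good where "good j I n x \<longleftrightarrow>
      Z j \<subseteq> (\<Union>i\<in>I. bowen_ball f (n i) (x i) \<epsilon>) \<and> (\<forall>i\<in>I. N \<le> n i) \<and>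
      (\<Sum>\<^sub>\<infinity>i\<in>I. ennreal (ball_weight f \<phi> \<alpha> (n i) (x i))) < ?c j + ennreal (e * (1/2)^Suc j)"
    for j and I :: "nat set" and n x
  have "\<exists>I n x. good j I n x" for j
  proof -
    \<comment> \<open>Finiteness of the total makes \<open>?c j\<close> finite; only then does
      adding a positive error give a strict inequality.\<close>
    have "?c j < ?c j + ennreal (e * (1/2)^Suc j)"
      using fin'[of j] e by (cases "?c j") (auto simp flip: ennreal_plus simp: ennreal_less_iff)
    then show ?thesis unfolding good_def by (rule cover_sum_lessE) blast
  qed
  then obtain I n x where good: "\<And>j. good j (I j) (n j) (x j)" by metis
  then have I: "\<And>j. Z j \<subseteq> (\<Union>i\<in>I j. bowen_ball f (n j i) (x j i) \<epsilon>)" "\<And>j i. i \<in> I j \<Longrightarrow> N \<le> n j i"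
      "\<And>j. (\<Sum>\<^sub>\<infinity>i\<in>I j. ennreal (ball_weight f \<phi> \<alpha> (n j i) (x j i))) \<le> ?c j + ennreal (e * (1/2)^Suc j)"
    unfolding good_def by (blast intro: less_imp_le)+
  let ?n = "\<lambda>(j, i). n j i" and ?x = "\<lambda>(j, i). x j i"
  let ?g = "\<lambda>(j, i). if i \<in> I j then ennreal (ball_weight f \<phi> \<alpha> (n j i) (x j i)) else 0"
  define J where "J = {p. prod_decode p \<in> (SIGMA j:UNIV. I j)}"
  have "cover_sum f \<phi> (\<Union>j. Z j) \<alpha> N \<epsilon> \<le>
     (\<Sum>\<^sub>\<infinity>p\<in>J. ennreal (ball_weight f \<phi> \<alpha> (?n (prod_decode p)) (?x (prod_decode p))))"
  proof (rule cover_sum_le_infsum)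
    show "(\<Union>j. Z j) \<subseteq> (\<Union>p\<in>J. bowen_ball f (?n (prod_decode p)) (?x (prod_decode p)) \<epsilon>)"
    proof
      fix z assume "z \<in> (\<Union>j. Z j)"
      then obtain j where "z \<in> Z j" by blast
      then obtain i where "i \<in> I j" "z \<in> bowen_ball f (n j i) (x j i) \<epsilon>"
        using I(1)[of j] by blast
      then show "z \<in> (\<Union>p\<in>J. bowen_ball f (?n (prod_decode p)) (?x (prod_decode p)) \<epsilon>)"
        by (intro UN_I[of "prod_encode (j, i)"]) (auto simp: J_def)
    qed
  qed (auto simp: J_def I(2))
  also have "\<dots> = (\<Sum>p. ?g (prod_decode p))"
    unfolding infsum_ennreal_nat by (intro suminf_cong) (auto simp: J_def split: prod.splits)
  also have "\<dots> = (\<Sum>j. \<Sum>i. ?g (j, i))"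
    by (rule suminf_ennreal_2dimen) simp
  also have "\<dots> = (\<Sum>j. \<Sum>\<^sub>\<infinity>i\<in>I j. ennreal (ball_weight f \<phi> \<alpha> (n j i) (x j i)))"
    unfolding infsum_ennreal_nat by simp
  also have "\<dots> \<le> (\<Sum>j. ?c j + ennreal (e * (1/2)^Suc j))"
    by (intro suminf_le I(3)) auto
  also have "\<dots> = (\<Sum>j. ?c j) + (\<Sum>j. ennreal (e * (1/2)^Suc j))"
    by (intro suminf_add[symmetric]) auto
  also have "(\<Sum>j. ennreal (e * (1/2)^Suc j)) = ennreal e"
  proof (rule suminf_ennreal_eq)
    show "(\<lambda>j. e * (1/2)^Suc j) sums e" using sums_mult[OF power_half_series, of e] by simp
  qed (use e in simp)
  finally show "cover_sum f \<phi> (\<Union>j. Z j) \<alpha> N \<epsilon> \<le> (\<Sum>j. ?c j) + ennreal e" .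
qed

text \<open>Raising \<open>N\<close> leaves fewer admissible covers, so the limit is a supremum.
  Later arguments can therefore fix one \<open>N\<close> at a time.\<close>

lemma cover_limit_eq_0_iff:
  "cover_limit f \<phi> Z \<alpha> \<epsilon> = 0 \<longleftrightarrow> (\<forall>N. cover_sum f \<phi> Z \<alpha> N \<epsilon> = 0)"
proof -
  have "(\<lambda>N. cover_sum f \<phi> Z \<alpha> N \<epsilon>) \<longlonglongrightarrow> (SUP N. cover_sum f \<phi> Z \<alpha> N \<epsilon>)"
    by (intro LIMSEQ_SUP) (auto simp: incseq_def intro: cover_sum_mono)
  then have "cover_limit f \<phi> Z \<alpha> \<epsilon> = (SUP N. cover_sum f \<phi> Z \<alpha> N \<epsilon>)"
    unfolding cover_limit_def by (rule limI)
  moreover have "(SUP N. cover_sum f \<phi> Z \<alpha> N \<epsilon>) = 0 \<longleftrightarrow> (\<forall>N. cover_sum f \<phi> Z \<alpha> N \<epsilon> = 0)"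
    by (metis (no_types, lifting) SUP_eq_iff UNIV_I UNIV_not_empty le_zero_eq SUP_upper zero_le)
  ultimately show ?thesis by simp
qed

lemma cover_limit_UN_eq_0:
  fixes Z :: "nat \<Rightarrow> 'a::metric_space set"
  assumes "\<And>j. cover_limit f \<phi> (Z j) \<alpha> \<epsilon> = 0"
  shows "cover_limit f \<phi> (\<Union>j. Z j) \<alpha> \<epsilon> = 0"
  unfolding cover_limit_eq_0_iff
proof
  fix N
  show "cover_sum f \<phi> (\<Union>j. Z j) \<alpha> N \<epsilon> = 0"
    using cover_sum_UN[of f \<phi> Z \<alpha> N \<epsilon>] assms unfolding cover_limit_eq_0_iff by simp
qed

lemma cover_limit_eq_0_mono:
  assumes "cover_limit f \<phi> Z' \<alpha>' \<epsilon>' = 0" "Z \<subseteq> Z'" "\<alpha>' \<le> \<alpha>" "\<epsilon>' \<le> \<epsilon>"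
  shows "cover_limit f \<phi> Z \<alpha> \<epsilon> = 0"
  using assms cover_sum_mono[OF assms(2) order_refl assms(3,4)]
  unfolding cover_limit_eq_0_iff by (metis le_zero_eq)

lemma set_pressure_at_le: "cover_limit f \<phi> Z \<alpha> \<epsilon> = 0 \<Longrightarrow> set_pressure_at f \<phi> Z \<epsilon> \<le> ereal \<alpha>"
  unfolding set_pressure_at_def by (intro Inf_lower) blast

lemma set_pressure_at_lessD:
  assumes "set_pressure_at f \<phi> Z \<epsilon> < ereal \<alpha>"
  shows "cover_limit f \<phi> Z \<alpha> \<epsilon> = 0"
proof -
  \<comment> \<open>The infimum only supplies some \<beta> below \<alpha>; the weights decrease in
    the exponent, so the limit is still zero at \<alpha>.\<close>
  obtain \<beta> where "\<beta> < \<alpha>" "cover_limit f \<phi> Z \<beta> \<epsilon> = 0"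
    using assms unfolding set_pressure_at_def Inf_less_iff by auto
  then show ?thesis using cover_limit_eq_0_mono[of f \<phi> Z \<beta> \<epsilon> Z \<alpha> \<epsilon>] by simp
qed

lemma set_pressure_at_antimono:
  assumes "\<epsilon>' \<le> \<epsilon>"
  shows "set_pressure_at f \<phi> Z \<epsilon> \<le> set_pressure_at f \<phi> Z \<epsilon>'"
  unfolding set_pressure_at_def
proof (rule Inf_superset_mono, safe)
  fix \<alpha> assume "cover_limit f \<phi> Z \<alpha> \<epsilon>' = 0"
  then have "cover_limit f \<phi> Z \<alpha> \<epsilon> = 0"
    by (rule cover_limit_eq_0_mono) (use assms in auto)
  then show "\<exists>\<alpha>'. ereal \<alpha> = ereal \<alpha>' \<and> cover_limit f \<phi> Z \<alpha>' \<epsilon> = 0" by blast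
qed

lemma measure_pressure_at_le:
  "Z \<in> sets \<mu> \<Longrightarrow> emeasure \<mu> Z = 1 \<Longrightarrow> measure_pressure_at f \<phi> \<mu> \<epsilon> \<le> set_pressure_at f \<phi> Z \<epsilon>"
  unfolding measure_pressure_at_def by (intro Inf_lower) blast

lemma measure_pressure_at_antimono:
  assumes "\<epsilon>' \<le> \<epsilon>"
  shows "measure_pressure_at f \<phi> \<mu> \<epsilon> \<le> measure_pressure_at f \<phi> \<mu> \<epsilon>'"
  unfolding measure_pressure_at_def[of f \<phi> \<mu> \<epsilon>']
  by (intro Inf_greatest)
    (auto intro!: order_trans[OF measure_pressure_at_le set_pressure_at_antimono[OF assms]])

text \<open>Smaller radii make covering harder, so the one-sided limit is monotone and exists in the
  extended reals.\<close>

lemma measure_pressure_eq_SUP: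
  "measure_pressure f \<phi> \<mu> = (SUP \<epsilon>\<in>{0<..}. measure_pressure_at f \<phi> \<mu> \<epsilon>)"
proof -
  let ?g = "measure_pressure_at f \<phi> \<mu>"
  have "(?g \<longlongrightarrow> (SUP \<epsilon>\<in>{0<..}. ?g \<epsilon>)) (at_right 0)"
  proof (rule order_tendstoI)
    fix a assume "a < (SUP \<epsilon>\<in>{0<..}. ?g \<epsilon>)"
    then obtain \<epsilon> where \<epsilon>: "0 < \<epsilon>" "a < ?g \<epsilon>" by (auto simp: less_SUP_iff)
    show "\<forall>\<^sub>F x in at_right 0. a < ?g x"
      unfolding eventually_at_right[OF \<epsilon>(1)]
    proof (intro exI[of _ \<epsilon>] conjI allI impI)
      fix y assume "0 < y" "y < \<epsilon>"
      then show "a < ?g y"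
        using \<epsilon>(2) measure_pressure_at_antimono[of y \<epsilon>] by (metis less_imp_le less_le_trans)
    qed (rule \<epsilon>(1))
  next
    fix a assume a: "(SUP \<epsilon>\<in>{0<..}. ?g \<epsilon>) < a"
    have "?g x < a" if "0 < x" for x
      using a that by (meson SUP_upper greaterThan_iff le_less_trans)
    then show "\<forall>\<^sub>F x in at_right 0. ?g x < a"
      by (auto simp: eventually_at_right[of 0 1] intro: exI[of _ 1])
  qed
  then show ?thesis unfolding measure_pressure_def by (intro tendsto_Lim) auto
qed

text \<open>Countably many radii suffice, which later allows almost-everywhere statements, one for
  each radius, to be combined.\<close>

lemma measure_pressure_leI:
  assumes "\<And>j::nat. measure_pressure_at f \<phi> \<mu> (1 / Suc j) \<le> c"
  shows "measure_pressure f \<phi> \<mu> \<le> c"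
  unfolding measure_pressure_eq_SUP
proof (rule SUP_least)
  fix \<epsilon> :: real assume "\<epsilon> \<in> {0<..}"
  then obtain j where "1 / Suc j < \<epsilon>"
    using nat_approx_posE[of \<epsilon>] by auto
  then show "measure_pressure_at f \<phi> \<mu> \<epsilon> \<le> c"
    by (intro order_trans[OF measure_pressure_at_antimono assms[of j]]) auto
qed

text \<open>Positivity of \<open>n\<close> makes the maximum in \<open>bowen_dist\<close> one over a
  nonempty set.\<close>

lemma mem_bowen_ball_iff:
  "0 < n \<Longrightarrow> y \<in> bowen_ball f n x \<epsilon> \<longleftrightarrow> (\<forall>i<n. dist ((f ^^ i) x) ((f ^^ i) y) < \<epsilon>)"
  unfolding bowen_ball_def bowen_dist_def by (subst mem_Collect_eq, subst Max_less_iff) auto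

section \<open>Itineraries and entropy\<close>

text \<open>Fekete's lemma; the limit is the infimum of \<open>a n / n\<close>. Division with
  remainder by a nearly optimal \<open>m\<close> bounds \<open>a n\<close> by \<open>n div m\<close>
  copies of \<open>a m\<close> and one remainder term.\<close>

lemma subadditive_convergent:
  fixes a :: "nat \<Rightarrow> real"
  assumes nonneg: "\<And>n. 0 \<le> a n" and sub: "\<And>m n. a (m + n) \<le> a m + a n"
  shows "convergent (\<lambda>n. a n / n)"
proof -
  define l where "l = (INF n\<in>{1..}. a n / n)"
  have bdd: "bdd_below ((\<lambda>n. a n / n) ` {1..})"
    by (intro bdd_belowI2[of _ 0]) (auto simp: nonneg)
  have lower: "l \<le> a n / n" if "1 \<le> n" for n
    unfolding l_def using that by (intro cINF_lower[OF bdd]) auto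
  have mult: "a (q * m) \<le> q * a m" if "0 < q" for q m
    using that
  proof (induction q rule: nat_induct_non_zero)
    case (Suc q)
    then show ?case using sub[of m "q * m"] by (simp add: algebra_simps)
  qed simp
  have "(\<lambda>n. a n / n) \<longlonglongrightarrow> l"
  proof (rule LIMSEQ_I)
    fix e :: real assume e: "0 < e"
    have "\<exists>m\<in>{1..}. a m / m < l + e / 2"
      using e cINF_less_iff[OF _ bdd, of "l + e / 2"] unfolding l_def by auto
    then obtain m where m: "1 \<le> m" "a m / m < l + e / 2" by auto
    \<comment> \<open>\<open>C\<close> bounds every remainder term \<open>a (n mod m)\<close>;
      \<open>n0\<close> makes its share of \<open>a n / n\<close> less than
      \<open>e / 2\<close>.\<close>
    define C where "C = Max (a ` {..<m})"
    have C: "a r \<le> C" if "r < m" for r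
      unfolding C_def using that by (intro Max_ge) auto
    obtain n0 :: nat where n0: "2 * \<bar>C\<bar> / e < n0" using reals_Archimedean2 by blast
    have "a n / n < l + e" if n: "max n0 m \<le> n" for n
    proof -
      have n1: "0 < n" using n m by auto
      have q: "0 < n div m" using n m by (simp add: div_greater_zero_iff)
      have le: "real (n div m) * m \<le> n"
        by (metis of_nat_mult of_nat_le_iff div_times_less_eq_dividend)
      have "a n \<le> a (n div m * m) + a (n mod m)"
        using sub[of "n div m * m" "n mod m"] by simp
      also have "\<dots> \<le> (n div m) * a m + \<bar>C\<bar>"
        using mult[OF q, of m] C[of "n mod m"] m by fastforce
      also have "(n div m) * a m = (real (n div m) * m) * (a m / m)" using m by simp
      also have "\<dots> \<le> n * (a m / m)"
        using le nonneg[of m] by (intro mult_right_mono) auto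
      also have "\<dots> \<le> n * (l + e / 2)" using m by (intro mult_left_mono) auto
      finally have 1: "a n \<le> n * (l + e / 2) + \<bar>C\<bar>" by simp
      have "\<bar>C\<bar> < n * (e / 2)"
      proof -
        have "2 * \<bar>C\<bar> / e < n" using n0 n by linarith
        then show ?thesis using e by (simp add: field_simps)
      qed
      with 1 have "a n < n * (l + e)" by (simp add: algebra_simps)
      then show ?thesis using n1 by (simp add: field_simps)
    qed
    then show "\<exists>no. \<forall>n\<ge>no. norm (a n / n - l) < e"
      using lower e m by (intro exI[of _ "max n0 m"]) fastforce
  qed
  then show ?thesis by (rule convergentI)
qed

section \<open>Words, itineraries and their distribution\<close>

definition words :: "nat \<Rightarrow> nat \<Rightarrow> nat list set" where
  "words k n = {w. set w \<subseteq> {..<k} \<and> length w = n}"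

definition itinerary :: "('a \<Rightarrow> 'a) \<Rightarrow> ('a \<Rightarrow> nat) \<Rightarrow> nat \<Rightarrow> 'a \<Rightarrow> nat list" where
  "itinerary f u n x = map (\<lambda>i. u ((f ^^ i) x)) [0..<n]"

lemma finite_words [simp]: "finite (words k n)"
  unfolding words_def by (rule finite_lists_length_eq) simp

lemma card_words: "card (words k n) = k ^ n"
  unfolding words_def by (subst card_lists_length_eq) auto

lemma words_0 [simp]: "words k 0 = {[]}"
  by (auto simp: words_def)

lemma length_itinerary [simp]: "length (itinerary f u n x) = n"
  by (simp add: itinerary_def)

lemma nth_itinerary: "i < n \<Longrightarrow> itinerary f u n x ! i = u ((f ^^ i) x)"
  by (simp add: itinerary_def)

lemma itinerary_in_words: "(\<And>x. u x < k) \<Longrightarrow> itinerary f u n x \<in> words k n"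
  by (auto simp: itinerary_def words_def)

lemma itinerary_eq_iff:
  "itinerary f u n x = itinerary f u n y \<longleftrightarrow> (\<forall>i<n. u ((f ^^ i) x) = u ((f ^^ i) y))"
  by (auto simp: itinerary_def)

lemma take_itinerary: "m \<le> n \<Longrightarrow> take m (itinerary f u n x) = itinerary f u m x"
  by (intro nth_equalityI) (auto simp: nth_itinerary)

lemma drop_itinerary: "drop m (itinerary f u n x) = itinerary f u (n - m) ((f ^^ m) x)"
  by (intro nth_equalityI) (auto simp: nth_itinerary funpow_add[symmetric, THEN fun_cong, simplified] add.commute)

text \<open>A word of length \<open>a + b\<close> is a pair of words, so Kraft sums multiply when
  codes are concatenated. The estimates for concatenated codes below rest on this.\<close>

lemma sum_words_add:
  fixes F G :: "nat list \<Rightarrow> real"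
  shows "(\<Sum>w\<in>words k (a + b). F (take a w) * G (drop a w)) =
    (\<Sum>v\<in>words k a. F v) * (\<Sum>v\<in>words k b. G v)"
proof -
  have "(\<Sum>v\<in>words k a. F v) * (\<Sum>v\<in>words k b. G v) =
      (\<Sum>(v, w)\<in>words k a \<times> words k b. F v * G w)"
    by (simp add: sum_product sum.cartesian_product)
  also have "\<dots> = (\<Sum>w\<in>words k (a + b). F (take a w) * G (drop a w))"
    by (rule sum.reindex_bij_witness[of _ "\<lambda>w. (take a w, drop a w)" "\<lambda>(v, w). v @ w"])
      (auto simp: words_def dest: in_set_takeD in_set_dropD)
  finally show ?thesis by simp
qed

locale invariant_system =
  fixes f :: "'a::metric_space \<Rightarrow> 'a" and M :: "'a measure"
  assumes continuous_f: "continuous_on UNIV f" and invariant: "M \<in> invariant_measures f"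

sublocale invariant_system \<subseteq> prob_space M
  using invariant by (simp add: invariant_measures_def)

lemma continuous_on_funpow:
  "continuous_on UNIV f \<Longrightarrow> continuous_on UNIV (f ^^ n)" for f :: "'a::topological_space \<Rightarrow> 'a"
proof (induction n)
  case (Suc n)
  then show ?case
    by (auto intro: continuous_on_compose2[of UNIV f UNIV "f ^^ n"] simp: o_def)
qed auto

context invariant_system
begin

lemma sets_M [measurable_cong]: "sets M = sets borel"
  using invariant by (simp add: invariant_measures_def)

lemma space_M [simp]: "space M = UNIV"
  using sets_eq_imp_space_eq[OF sets_M] by simp

lemma measurable_funpow [measurable]: "f ^^ n \<in> borel_measurable borel"
  by (intro borel_measurable_continuous_onI continuous_on_funpow continuous_f)

lemma measurable_f [measurable]: "f \<in> borel_measurable borel"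
  by (intro borel_measurable_continuous_onI continuous_f)

lemma distr_funpow: "distr M borel (f ^^ n) = M"
proof (induction n)
  case 0
  then show ?case using distr_id2[OF sets_M[symmetric]] by (simp add: id_def)
next
  case (Suc n)
  have "distr M borel (f ^^ Suc n) = distr (distr M borel (f ^^ n)) borel f"
    by (subst distr_distr) (auto simp: o_def)
  also have "\<dots> = M" using invariant by (simp add: Suc invariant_measures_def)
  finally show ?case .
qed

lemma integral_funpow:
  fixes g :: "'a \<Rightarrow> real"
  assumes "g \<in> borel_measurable borel"
  shows "(\<integral>x. g ((f ^^ n) x) \<partial>M) = (\<integral>x. g x \<partial>M)"
  using assms integral_distr[of "f ^^ n" M borel g] by (simp add: distr_funpow)

lemma integrable_funpow:
  fixes g :: "'a \<Rightarrow> real"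
  assumes "integrable M g"
  shows "integrable M (\<lambda>x. g ((f ^^ n) x))"
  using integrable_distr[of "f ^^ n" M borel g] assms by (simp add: distr_funpow)

lemma AE_funpow:
  assumes "AE x in M. P x"
  shows "AE x in M. P ((f ^^ n) x)"
proof (rule AE_distrD[of "f ^^ n" M borel P])
  show "AE x in distr M borel (f ^^ n). P x" using assms by (simp only: distr_funpow)
qed measurable

end

locale labelled_system = invariant_system f M
  for f :: "'a::metric_space \<Rightarrow> 'a" and M :: "'a measure" +
  fixes u :: "'a \<Rightarrow> nat" and k :: nat
  assumes label_measurable [measurable]: "u \<in> borel \<rightarrow>\<^sub>M count_space UNIV"
    and label_less: "u x < k"
begin

text \<open>Lists of naturals form a countable type, so only single words have to be
  checked.\<close>

lemma measurable_itinerary [measurable]: "itinerary f u n \<in> borel \<rightarrow>\<^sub>M count_space UNIV"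
proof (rule measurableI)
  have eq: "itinerary f u n -` {w} \<inter> space borel =
      (if length w = n then {x \<in> space borel. \<forall>i<n. u ((f ^^ i) x) = w ! i} else {})" for w
    by (auto simp: list_eq_iff_nth_eq nth_itinerary)
  have 1: "itinerary f u n -` {w} \<inter> space borel \<in> sets borel" for w
  proof -
    have "{x \<in> space borel. \<forall>i<n. u ((f ^^ i) x) = w ! i} \<in> sets borel" by measurable
    then show ?thesis unfolding eq by simp
  qed
  fix A :: "nat list set"
  have "itinerary f u n -` A \<inter> space borel = (\<Union>w\<in>A. itinerary f u n -` {w} \<inter> space borel)"
    by auto
  also have "\<dots> \<in> sets borel"
  proof (rule sets.countable_UN'')
    show "countable A" by simp
  qed (rule 1)
  finally show "itinerary f u n -` A \<inter> space borel \<in> sets borel" .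
qed simp

definition word_prob :: "nat \<Rightarrow> nat list \<Rightarrow> real" where
  "word_prob n w = measure M {x. itinerary f u n x = w}"

definition word_entropy :: "nat \<Rightarrow> real" where
  "word_entropy n = - (\<Sum>w\<in>words k n. word_prob n w * ln (word_prob n w))"

lemma itinerary_in [simp]: "itinerary f u n x \<in> words k n"
  by (rule itinerary_in_words, rule label_less)

lemma itinerary_sets [measurable]: "{x. itinerary f u n x = w} \<in> sets borel"
  using measurable_sets[OF measurable_itinerary, of "{w}" n] by (simp add: vimage_def)

lemma word_prob_nonneg [simp]: "0 \<le> word_prob n w"
  by (simp add: word_prob_def)

lemma
  fixes g :: "nat list \<Rightarrow> real"
  shows integral_itinerary: "(\<integral>x. g (itinerary f u n x) \<partial>M) = (\<Sum>w\<in>words k n. word_prob n w * g w)"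
    and integrable_itinerary: "integrable M (\<lambda>x. g (itinerary f u n x))"
proof -
  have eq: "g (itinerary f u n x) = (\<Sum>w\<in>words k n. indicator {x. itinerary f u n x = w} x * g w)" for x
  proof -
    have "(\<Sum>w\<in>words k n. indicator {x. itinerary f u n x = w} x * g w) =
        (\<Sum>w\<in>words k n. if itinerary f u n x = w then g w else 0)"
      by (intro sum.cong) (simp_all add: indicator_def)
    then show ?thesis by simp
  qed
  have int: "integrable M (\<lambda>x. indicator {x. itinerary f u n x = w} x * g w)" for w
    by (intro integrable_mult_left integrable_real_indicator) (auto simp: sets_M less_top[symmetric])
  show "integrable M (\<lambda>x. g (itinerary f u n x))"
    unfolding eq by (intro Bochner_Integration.integrable_sum int)
  show "(\<integral>x. g (itinerary f u n x) \<partial>M) = (\<Sum>w\<in>words k n. word_prob n w * g w)"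
  proof -
    have "(\<integral>x. g (itinerary f u n x) \<partial>M) =
        (\<integral>x. (\<Sum>w\<in>words k n. indicator {x. itinerary f u n x = w} x * g w) \<partial>M)"
      by (simp only: eq)
    also have "\<dots> = (\<Sum>w\<in>words k n. \<integral>x. indicator {x. itinerary f u n x = w} x * g w \<partial>M)"
      by (rule Bochner_Integration.integral_sum[OF int])
    finally show ?thesis by (simp add: word_prob_def)
  qed
qed

lemma sum_word_prob: "(\<Sum>w\<in>words k n. word_prob n w) = 1"
  using integral_itinerary[of "\<lambda>_. 1" n] prob_space by simp

lemma word_entropy_nonneg: "0 \<le> word_entropy n"
proof -
  have "word_prob n w * ln (word_prob n w) \<le> 0" for w
  proof (cases "word_prob n w = 0")
    case False
    then have "0 < word_prob n w" using word_prob_nonneg[of n w] by linarith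
    moreover have "word_prob n w \<le> 1" by (simp add: word_prob_def)
    ultimately show ?thesis by (intro mult_nonneg_nonpos) auto
  qed simp
  then show ?thesis unfolding word_entropy_def by (simp add: sum_nonpos)
qed

text \<open>The null words are finite in number and can be discarded together. Positivity is needed
  to split the logarithm of a product of probabilities.\<close>

lemma AE_word_prob_pos: "AE x in M. 0 < word_prob n (itinerary f u n x)"
proof -
  have "AE x in M. itinerary f u n x \<noteq> w" if "word_prob n w = 0" for w
    using that by (intro AE_not_in[of "{x. itinerary f u n x = w}", simplified])
      (auto simp: null_sets_def word_prob_def emeasure_eq_measure sets_M)
  then have "AE x in M. \<forall>w\<in>{w \<in> words k n. word_prob n w = 0}. itinerary f u n x \<noteq> w"
    by (intro AE_finite_allI) auto
  then show ?thesis
    by eventually_elim (use word_prob_nonneg itinerary_in in \<open>force simp: less_le\<close>)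
qed

text \<open>Gibbs' inequality, with \<open>G\<close> a bound on the length of the code \<open>q\<close>.\<close>

lemma word_entropy_le:
  fixes q :: "nat list \<Rightarrow> real"
  assumes q: "\<And>w. w \<in> words k n \<Longrightarrow> 0 \<le> q w" "(\<Sum>w\<in>words k n. q w) \<le> 1"
    and pos_AE: "AE x in M. 0 < q (itinerary f u n x)"
    and G: "integrable M G" "AE x in M. - ln (q (itinerary f u n x)) \<le> G x"
  shows "word_entropy n \<le> (\<integral>x. G x \<partial>M)"
proof -
  \<comment> \<open>A word of positive probability cannot lie inside the null set where
    \<open>q\<close> of the itinerary fails to be positive, so \<open>ln (q w)\<close> is meaningful
    for every word that carries mass.\<close>
  have pos: "0 < q w" if "0 < word_prob n w" for w
  proof (rule ccontr)
    assume "\<not> 0 < q w"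
    then have "AE x in M. x \<notin> {x. itinerary f u n x = w}"
      using pos_AE by (auto elim: eventually_mono)
    then have "word_prob n w = 0"
      unfolding word_prob_def by (subst prob_eq_0) (auto simp: sets_M)
    then show False using that by simp
  qed
  have "(\<Sum>w\<in>words k n. word_prob n w * (ln (q w) - ln (word_prob n w))) \<le>
      (\<Sum>w\<in>words k n. q w - word_prob n w)"
  proof (rule sum_mono)
    fix w assume w: "w \<in> words k n"
    show "word_prob n w * (ln (q w) - ln (word_prob n w)) \<le> q w - word_prob n w"
    proof (cases "word_prob n w = 0")
      case False
      then have p: "0 < word_prob n w" using word_prob_nonneg[of n w] by linarith
      have "ln (q w) - ln (word_prob n w) = ln (q w / word_prob n w)"
        using p pos[OF p] by (simp add: ln_div)
      also have "\<dots> \<le> q w / word_prob n w - 1"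
        using p pos[OF p] by (intro ln_le_minus_one) auto
      finally show ?thesis using p by (simp add: field_simps)
    qed (use q(1)[OF w] in simp)
  qed
  also have "\<dots> \<le> 0" using q(2) by (simp add: sum_subtractf sum_word_prob)
  finally have "word_entropy n \<le> (\<Sum>w\<in>words k n. word_prob n w * - ln (q w))"
    by (simp add: word_entropy_def sum_subtractf right_diff_distrib sum_negf)
  also have "\<dots> = (\<integral>x. - ln (q (itinerary f u n x)) \<partial>M)"
    using integral_itinerary[of "\<lambda>w. - ln (q w)" n] by simp
  also have "\<dots> \<le> (\<integral>x. G x \<partial>M)"
    using G integrable_itinerary[of "\<lambda>w. - ln (q w)" n] by (intro integral_mono_AE) auto
  finally show ?thesis .
qed

lemma word_entropy_eq_integral:
  "word_entropy n = (\<integral>x. - ln (word_prob n (itinerary f u n x)) \<partial>M)"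
  using integral_itinerary[of "\<lambda>w. - ln (word_prob n w)" n]
  by (simp add: word_entropy_def sum_negf)

text \<open>Gibbs' inequality for the product code: the first \<open>m\<close> symbols are coded by
  their own distribution and the last \<open>n\<close> by theirs. By invariance the second length
  has the same mean at \<open>(f ^^ m) x\<close> as at \<open>x\<close>.\<close>

lemma word_entropy_add: "word_entropy (m + n) \<le> word_entropy m + word_entropy n"
proof -
  let ?q = "\<lambda>w. word_prob m (take m w) * word_prob n (drop m w)"
  let ?G1 = "\<lambda>x. - ln (word_prob m (itinerary f u m x))"
  let ?G2 = "\<lambda>x. - ln (word_prob n (itinerary f u n x))"
  have meas2: "?G2 \<in> borel_measurable borel"
    by (rule measurable_compose[OF measurable_itinerary]) simp
  have int2: "integrable M (\<lambda>x. ?G2 ((f ^^ m) x))"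
    by (rule integrable_funpow[OF integrable_itinerary])
  have ae: "AE x in M. 0 < word_prob m (itinerary f u m x) \<and> 0 < word_prob n (itinerary f u n ((f ^^ m) x))"
    using AE_word_prob_pos[of m] AE_funpow[OF AE_word_prob_pos[of n], of m] by auto
  have it: "take m (itinerary f u (m + n) x) = itinerary f u m x"
    "drop m (itinerary f u (m + n) x) = itinerary f u n ((f ^^ m) x)" for x
    by (simp_all add: take_itinerary drop_itinerary)
  have "word_entropy (m + n) \<le> (\<integral>x. ?G1 x + ?G2 ((f ^^ m) x) \<partial>M)"
  proof (rule word_entropy_le[where q = ?q])
    show "(\<Sum>w\<in>words k (m + n). ?q w) \<le> 1"
      by (subst sum_words_add) (simp add: sum_word_prob)
    show "AE x in M. 0 < ?q (itinerary f u (m + n) x)"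
      using ae by eventually_elim (simp add: it)
    show "AE x in M. - ln (?q (itinerary f u (m + n) x)) \<le> ?G1 x + ?G2 ((f ^^ m) x)"
      using ae by eventually_elim (simp add: it ln_mult)
  qed (use int2 integrable_itinerary[of "\<lambda>w. - ln (word_prob m w)" m] in auto)
  also have "\<dots> = (\<integral>x. ?G1 x \<partial>M) + (\<integral>x. ?G2 ((f ^^ m) x) \<partial>M)"
    using int2 integrable_itinerary[of "\<lambda>w. - ln (word_prob m w)" m] by (intro Bochner_Integration.integral_add)
  also have "(\<integral>x. ?G2 ((f ^^ m) x) \<partial>M) = (\<integral>x. ?G2 x \<partial>M)"
    by (rule integral_funpow[OF meas2])
  finally show ?thesis by (simp add: word_entropy_eq_integral)
qed

definition label_entropy :: real where
  "label_entropy = lim (\<lambda>n. word_entropy n / n)"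

lemma word_entropy_LIMSEQ: "(\<lambda>n. word_entropy n / n) \<longlonglongrightarrow> label_entropy"
  unfolding label_entropy_def
  using subadditive_convergent[of word_entropy, OF word_entropy_nonneg word_entropy_add]
  by (simp add: convergent_LIMSEQ_iff)

end

text \<open>A value below \<open>k\<close> that \<open>u\<close> misses would give an empty cell,
  which \<open>partition_on\<close> forbids.\<close>

definition label_partition :: "('a \<Rightarrow> nat) \<Rightarrow> nat \<Rightarrow> 'a set set" where
  "label_partition u k = (\<lambda>i. u -` {i}) ` {..<k} - {{}}"

text \<open>Any point of a nonempty intersection determines every factor, namely as the cell of its
  label at that time; so the nonempty cells are the classes of equal itinerary.\<close>

lemma dynamical_join_label_partition:
  assumes "\<And>x. u x < k"
  shows "dynamical_join f (label_partition u k) n = range (\<lambda>x. {y. itinerary f u n y = itinerary f u n x})"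
proof (intro antisym subsetI)
  fix B assume "B \<in> dynamical_join f (label_partition u k) n"
  then obtain A where A: "A \<in> {..<n} \<rightarrow>\<^sub>E label_partition u k" "B = (\<Inter>i<n. (f ^^ i) -` A i)" "B \<noteq> {}"
    unfolding dynamical_join_def by auto
  then obtain x where x: "\<And>i. i < n \<Longrightarrow> (f ^^ i) x \<in> A i" by auto
  have "A i = u -` {u ((f ^^ i) x)}" if "i < n" for i
  proof -
    have "A i \<in> label_partition u k" using A(1) that by auto
    then show ?thesis using x[OF that] by (auto simp: label_partition_def)
  qed
  then have "B = {y. itinerary f u n y = itinerary f u n x}"
    using A(2) by (auto simp: itinerary_eq_iff)
  then show "B \<in> range (\<lambda>x. {y. itinerary f u n y = itinerary f u n x})" by auto
next
  fix B assume "B \<in> range (\<lambda>x. {y. itinerary f u n y = itinerary f u n x})"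
  then obtain x where B: "B = {y. itinerary f u n y = itinerary f u n x}" by auto
  let ?A = "restrict (\<lambda>i. u -` {u ((f ^^ i) x)}) {..<n}"
  have "?A \<in> {..<n} \<rightarrow>\<^sub>E label_partition u k"
    using assms by (auto simp: label_partition_def)
  moreover have "B = (\<Inter>i<n. (f ^^ i) -` ?A i)"
    unfolding B by (auto simp: itinerary_eq_iff)
  moreover have "B \<noteq> {}" using B by auto
  ultimately show "B \<in> dynamical_join f (label_partition u k) n"
    unfolding dynamical_join_def by blast
qed

lemma (in labelled_system) partition_entropy_label_partition:
  "partition_entropy M (dynamical_join f (label_partition u k) n) = word_entropy n"
proof -
  let ?W = "range (itinerary f u n)" and ?B = "\<lambda>w. {y. itinerary f u n y = w}"
  have "dynamical_join f (label_partition u k) n = ?B ` ?W"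
    by (subst dynamical_join_label_partition[OF label_less]) (auto simp: image_image)
  moreover have "inj_on ?B ?W" by (auto simp: inj_on_def)
  ultimately have "partition_entropy M (dynamical_join f (label_partition u k) n) =
      - (\<Sum>w\<in>?W. word_prob n w * ln (word_prob n w))"
    unfolding partition_entropy_def by (simp add: sum.reindex word_prob_def)
  also have "(\<Sum>w\<in>?W. word_prob n w * ln (word_prob n w)) =
      (\<Sum>w\<in>words k n. word_prob n w * ln (word_prob n w))"
  proof (rule sum.mono_neutral_left)
    have "word_prob n w = 0" if "w \<notin> ?W" for w
    proof -
      have "{x. itinerary f u n x = w} = {}" using that by auto
      then show ?thesis by (simp add: word_prob_def)
    qed
    then show "\<forall>w\<in>words k n - ?W. word_prob n w * ln (word_prob n w) = 0" by auto
  qed auto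
  finally show ?thesis by (simp add: word_entropy_def)
qed

lemma (in labelled_system) entropy_wrt_label_partition:
  "entropy_wrt f M (label_partition u k) = label_entropy"
  by (simp add: entropy_wrt_def label_entropy_def partition_entropy_label_partition)

text \<open>Lets the supremum in \<open>KS_entropy\<close> be taken over labellings: enumerate the
  cells and label a point by the index of its cell.\<close>

lemma finite_partition_labelE:
  assumes "finite P" "partition_on UNIV P" "P \<subseteq> sets borel"
  obtains u :: "'a::topological_space \<Rightarrow> nat" and k where "u \<in> borel \<rightarrow>\<^sub>M count_space UNIV"
    "\<And>x. u x < k" "P = label_partition u k"
proof -
  obtain h where h: "bij_betw h {0..<card P} P"
    using ex_bij_betw_nat_finite[OF assms(1)] by blast
  define u where "u x = (THE i. i < card P \<and> x \<in> h i)" for x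
  have ex: "\<exists>!i. i < card P \<and> x \<in> h i" for x
  proof -
    obtain A where A: "A \<in> P" "x \<in> A" using assms(2) by (auto simp: partition_on_def)
    then have "A \<in> h ` {0..<card P}" using h by (simp add: bij_betw_def)
    then obtain i where i: "i < card P" "h i = A" by auto
    have "j = i" if "j < card P" "x \<in> h j" for j
    proof -
      have "h j \<in> P" using h that by (auto simp: bij_betw_def)
      then have "h j = h i" using that A i assms(2) unfolding partition_on_def disjoint_def by blast
      then show ?thesis using h that i by (auto simp: bij_betw_def inj_on_def)
    qed
    then show ?thesis using i A by blast
  qed
  have u1: "u x < card P" "x \<in> h (u x)" for x
    using theI'[OF ex[of x]] unfolding u_def by auto
  have u2: "u -` {i} = h i" if "i < card P" for i
  proof -
    have "u x = i" if "x \<in> h i" for x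
      unfolding u_def by (rule the1_equality[OF ex]) (use that \<open>i < card P\<close> in auto)
    then show ?thesis using u1 by (auto simp: vimage_def)
  qed
  have pre: "u -` A = (\<Union>i\<in>A \<inter> {..<card P}. h i)" for A
    using u1 u2 by fastforce
  show thesis
  proof
    show "u \<in> borel \<rightarrow>\<^sub>M count_space UNIV"
    proof (rule measurableI)
      fix A :: "nat set"
      have "h i \<in> sets borel" if "i < card P" for i
        using h that assms(3) by (auto simp: bij_betw_def)
      then show "u -` A \<inter> space borel \<in> sets borel"
        by (auto simp: pre intro!: sets.countable_UN')
    qed simp
    have "{} \<notin> P" using assms(2) by (simp add: partition_on_def)
    moreover have "P = h ` {..<card P}" using h by (auto simp: bij_betw_def lessThan_atLeast0)
    ultimately show "P = label_partition u (card P)"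
      unfolding label_partition_def using u2 by (auto simp: image_iff)
  qed (rule u1)
qed

lemma (in labelled_system) partition_label_partition:
  "finite (label_partition u k)" "label_partition u k \<subseteq> sets M" "partition_on (space M) (label_partition u k)"
proof -
  show "label_partition u k \<subseteq> sets M"
    using measurable_sets[OF label_measurable] by (auto simp: label_partition_def sets_M)
  show "partition_on (space M) (label_partition u k)"
    using label_less by (auto simp: partition_on_def label_partition_def disjoint_def)
qed (simp add: label_partition_def)

lemma (in labelled_system) label_entropy_le_KS_entropy: "ereal label_entropy \<le> KS_entropy f M"
  unfolding KS_entropy_def using partition_label_partition
  by (intro SUP_upper2[of "label_partition u k"]) (auto simp: entropy_wrt_label_partition)

lemma (in invariant_system) KS_entropy_leI:
  assumes "\<And>u k. labelled_system f M u k \<Longrightarrow> ereal (labelled_system.label_entropy f M u k) \<le> c"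
  shows "KS_entropy f M \<le> c"
  unfolding KS_entropy_def
proof (rule SUP_least)
  fix P assume "P \<in> {P. finite P \<and> P \<subseteq> sets M \<and> partition_on (space M) P}"
  then obtain u :: "'a \<Rightarrow> nat" and k where u: "u \<in> borel \<rightarrow>\<^sub>M count_space UNIV"
    "\<And>x. u x < k" "P = label_partition u k"
    using finite_partition_labelE[of P] by (auto simp: sets_M)
  then interpret labelled_system f M u k by unfold_locales
  show "ereal (entropy_wrt f M P) \<le> c"
    using assms[of u k] labelled_system_axioms by (simp add: u(3) entropy_wrt_label_partition)
qed

section \<open>Bounded Birkhoff sums and block codes\<close>

lemma birkhoff_sum_Suc:
  "birkhoff_sum f \<psi> (Suc n) x = \<psi> x + birkhoff_sum f \<psi> n (f x)"
  unfolding birkhoff_sum_def by (subst sum.lessThan_Suc_shift) (simp add: funpow_swap1)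

text \<open>This is the maximum of \<open>birkhoff_sum f \<psi> i x\<close> over
  \<open>i \<le> n\<close>, the empty sum included. The recursion directly yields the difference
  between the value at \<open>Suc n\<close> and the shifted value at \<open>n\<close>, on which the
  maximal ergodic argument rests.\<close>

primrec max_birkhoff_sum :: "('a \<Rightarrow> 'a) \<Rightarrow> ('a \<Rightarrow> real) \<Rightarrow> nat \<Rightarrow> 'a \<Rightarrow> real" where
  "max_birkhoff_sum f \<psi> 0 x = 0"
| "max_birkhoff_sum f \<psi> (Suc n) x = max 0 (\<psi> x + max_birkhoff_sum f \<psi> n (f x))"

lemma max_birkhoff_sum_nonneg: "0 \<le> max_birkhoff_sum f \<psi> n x"
  by (cases n) auto

lemma birkhoff_sum_le_max: "birkhoff_sum f \<psi> n x \<le> max_birkhoff_sum f \<psi> n x"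
proof (induction n arbitrary: x)
  case (Suc n)
  from Suc[of "f x"] show ?case by (simp add: birkhoff_sum_Suc)
qed (simp add: birkhoff_sum_def)

lemma max_birkhoff_sum_mono: "max_birkhoff_sum f \<psi> n x \<le> max_birkhoff_sum f \<psi> (Suc n) x"
proof (induction n arbitrary: x)
  case (Suc n)
  from Suc[of "f x"] show ?case by simp
qed (simp)

context invariant_system
begin

lemma measurable_max_birkhoff_sum [measurable]:
  assumes [measurable]: "\<psi> \<in> borel_measurable borel"
  shows "max_birkhoff_sum f \<psi> n \<in> borel_measurable borel"
proof (induction n)
  case 0
  have "max_birkhoff_sum f \<psi> 0 = (\<lambda>x. 0)" by auto
  then show ?case by simp
next
  case (Suc n)
  note [measurable] = Suc
  have "max_birkhoff_sum f \<psi> (Suc n) = (\<lambda>x. max 0 (\<psi> x + max_birkhoff_sum f \<psi> n (f x)))" by auto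
  then show ?case by simp
qed

lemma integrable_max_birkhoff_sum:
  assumes [measurable]: "\<psi> \<in> borel_measurable borel" and int: "integrable M \<psi>"
  shows "integrable M (max_birkhoff_sum f \<psi> n)"
proof (induction n)
  case 0
  have "max_birkhoff_sum f \<psi> 0 = (\<lambda>x. 0)" by auto
  then show ?case by simp
next
  case (Suc n)
  have eq: "max_birkhoff_sum f \<psi> (Suc n) = (\<lambda>x. max 0 (\<psi> x + max_birkhoff_sum f \<psi> n (f x)))" by auto
  have "integrable M (\<lambda>x. max_birkhoff_sum f \<psi> n (f x))"
    using integrable_funpow[OF Suc, of 1] by simp
  then show ?case unfolding eq using int by (intro integrable_max) auto
qed

text \<open>The set \<open>E\<close> of unbounded maxima is invariant, so ergodicity leaves measure
  0 or 1. If it were 1, the differences \<open>?m (Suc n) x - ?m n (f x)\<close> would tend to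
  \<open>\<psi> x\<close> almost everywhere, dominated by the absolute value of \<psi>. Their
  integrals are nonnegative by invariance and monotonicity in \<open>n\<close>, which contradicts
  the negative mean of \<psi>.\<close>

lemma ergodic_bounded_birkhoff_sums:
  assumes erg: "M \<in> ergodic_measures f"
    and meas [measurable]: "\<psi> \<in> borel_measurable borel" and int: "integrable M \<psi>"
    and neg: "(\<integral>x. \<psi> x \<partial>M) < 0"
  shows "AE x in M. \<exists>C::nat. \<forall>n. birkhoff_sum f \<psi> n x \<le> C"
proof -
  let ?m = "max_birkhoff_sum f \<psi>"
  define E where "E = {x. \<forall>C::nat. \<exists>n. C < ?m n x}"
  have E [measurable]: "E \<in> sets borel"
    unfolding E_def by measurable
  have "f -` E = E"
  proof (intro set_eqI iffI)
    fix x assume "x \<in> f -` E"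
    then have *: "\<exists>n. C < ?m n (f x)" for C :: nat by (simp add: E_def)
    have "\<exists>n. C < ?m n x" for C :: nat
    proof -
      \<comment> \<open>Passing between \<open>f x\<close> and \<open>x\<close> changes the sums by
        \<open>\<psi> x\<close>; asking for that much more than the desired bound \<open>C\<close>
        compensates for it.\<close>
      obtain n where "nat \<lceil>C + \<bar>\<psi> x\<bar>\<rceil> < ?m n (f x)" using * by blast
      then have "C < ?m (Suc n) x" by (simp; linarith)
      then show ?thesis by blast
    qed
    then show "x \<in> E" by (simp add: E_def)
  next
    fix x assume "x \<in> E"
    then have *: "\<exists>n. C < ?m n x" for C :: nat by (simp add: E_def)
    have "\<exists>n. C < ?m n (f x)" for C :: nat
    proof -
      obtain n where n: "nat \<lceil>C + \<bar>\<psi> x\<bar>\<rceil> < ?m n x" using * by blast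
      then obtain n' where "n = Suc n'" by (cases n) auto
      then have "C < ?m n' (f x)" using n by (simp; linarith)
      then show ?thesis by blast
    qed
    then show "x \<in> f -` E" by (simp add: E_def)
  qed
  then have "measure M E = 0 \<or> measure M E = 1"
    using erg E by (simp add: ergodic_measures_def)
  moreover have "measure M E \<noteq> 1"
  proof
    assume "measure M E = 1"
    then have AE_E: "AE x in M. x \<in> E"
      by (subst (asm) prob_eq_1) (auto simp: sets_M)
    let ?d = "\<lambda>n x. max (- ?m n (f x)) (\<psi> x)"
    have "(\<lambda>n. \<integral>x. ?d n x \<partial>M) \<longlonglongrightarrow> (\<integral>x. \<psi> x \<partial>M)"
    proof (rule integral_dominated_convergence[where w = "\<lambda>x. \<bar>\<psi> x\<bar>"])
      show "AE x in M. (\<lambda>n. ?d n x) \<longlonglongrightarrow> \<psi> x"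
        using AE_E
      proof eventually_elim
        fix x assume "x \<in> E"
        then have "f x \<in> E" using \<open>f -` E = E\<close> by auto
        then obtain n0 where n0: "nat \<lceil>\<bar>\<psi> x\<bar>\<rceil> < ?m n0 (f x)" unfolding E_def by blast
        have "?d n x = \<psi> x" if "n0 \<le> n" for n
        proof -
          have "?m n0 (f x) \<le> ?m n (f x)"
            using lift_Suc_mono_le[of "\<lambda>n. ?m n (f x)", OF max_birkhoff_sum_mono that] .
          then show ?thesis using n0 by linarith
        qed
        then show "(\<lambda>n. ?d n x) \<longlonglongrightarrow> \<psi> x"
          by (intro tendsto_eventually) (auto simp: eventually_sequentially)
      qed
      show "AE x in M. norm (?d n x) \<le> \<bar>\<psi> x\<bar>" for n
      proof (rule AE_I2)
        fix x show "norm (?d n x) \<le> \<bar>\<psi> x\<bar>"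
          using max_birkhoff_sum_nonneg[of f \<psi> n "f x"] by (simp add: max_def)
      qed
    qed (use int in auto)
    moreover have "0 \<le> (\<integral>x. ?d n x \<partial>M)" for n
    proof -
      have i1: "integrable M (\<lambda>x. ?m n (f x))"
        using integrable_funpow[OF integrable_max_birkhoff_sum[OF meas int, of n], of 1] by simp
      have "?d n x = ?m (Suc n) x - ?m n (f x)" for x by (simp add: max_def)
      then have 1: "(\<integral>x. ?d n x \<partial>M) = (\<integral>x. ?m (Suc n) x \<partial>M) - (\<integral>x. ?m n (f x) \<partial>M)"
        by (simp only: Bochner_Integration.integral_diff[OF integrable_max_birkhoff_sum[OF meas int] i1])
      have "(\<integral>x. ?m n (f x) \<partial>M) = (\<integral>x. ?m n x \<partial>M)"
        using integral_funpow[of "?m n" 1] by simp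
      also have "\<dots> \<le> (\<integral>x. ?m (Suc n) x \<partial>M)"
        by (intro integral_mono integrable_max_birkhoff_sum meas int max_birkhoff_sum_mono)
      finally show ?thesis using 1 by simp
    qed
    ultimately have "0 \<le> (\<integral>x. \<psi> x \<partial>M)" using LIMSEQ_le_const by blast
    then show False using neg by simp
  qed
  ultimately have "AE x in M. x \<notin> E"
    by (subst (asm) prob_eq_0) (auto simp: sets_M)
  then show ?thesis
  proof eventually_elim
    fix x assume "x \<notin> E"
    then obtain C :: nat where "\<And>n. ?m n x \<le> C" by (auto simp: E_def not_less)
    then show "\<exists>C::nat. \<forall>n. birkhoff_sum f \<psi> n x \<le> C"
      using birkhoff_sum_le_max order_trans by metis
  qed
qed

text \<open>Adding \<open>c\<close>, half the absolute value of the mean, keeps the mean negative.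
  The sums of \<open>\<psi> + c\<close> are then bounded, so those of \<psi> are at most
  \<open>C - n * c\<close>, which is eventually nonpositive.\<close>

lemma ergodic_birkhoff_sums_nonpos:
  assumes erg: "M \<in> ergodic_measures f"
    and meas [measurable]: "\<psi> \<in> borel_measurable borel" and int: "integrable M \<psi>"
    and neg: "(\<integral>x. \<psi> x \<partial>M) < 0"
  shows "AE x in M. \<forall>\<^sub>F n in sequentially. birkhoff_sum f \<psi> n x \<le> 0"
proof -
  define c where "c = - (\<integral>x. \<psi> x \<partial>M) / 2"
  have c: "0 < c" using neg by (simp add: c_def)
  have "AE x in M. \<exists>C::nat. \<forall>n. birkhoff_sum f (\<lambda>x. \<psi> x + c) n x \<le> C"
    using int neg by (intro ergodic_bounded_birkhoff_sums erg) (auto simp: prob_space[simplified] c_def)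
  then show ?thesis
  proof eventually_elim
    fix x assume "\<exists>C::nat. \<forall>n. birkhoff_sum f (\<lambda>x. \<psi> x + c) n x \<le> C"
    then obtain C :: nat where C: "birkhoff_sum f \<psi> n x + n * c \<le> C" for n
      by (auto simp: birkhoff_sum_def sum.distrib)
    obtain n0 :: nat where n0: "C / c < n0" using reals_Archimedean2 by blast
    have "birkhoff_sum f \<psi> n x \<le> 0" if "n0 \<le> n" for n
    proof -
      have "C / c \<le> n" using n0 that by linarith
      then have "C \<le> n * c" using c by (simp add: field_simps)
      then show ?thesis using C[of n] by linarith
    qed
    then show "\<forall>\<^sub>F n in sequentially. birkhoff_sum f \<psi> n x \<le> 0"
      by (auto simp: eventually_sequentially)
  qed
qed

end

text \<open>Finitely many balls of radius \<open>\<epsilon> / 2\<close> cover the space; a point is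
  labelled by the first ball containing it, so points with a common label are close to a common
  centre.\<close>

lemma small_diameter_labelling:
  assumes "compact (UNIV :: 'a::metric_space set)" "0 < \<epsilon>"
  obtains u :: "'a::metric_space \<Rightarrow> nat" and k where "u \<in> borel \<rightarrow>\<^sub>M count_space UNIV" "\<And>x. u x < k"
    "\<And>x y. u x = u y \<Longrightarrow> dist x y < \<epsilon>"
proof -
  obtain C :: "'a set" where C: "finite C" "UNIV \<subseteq> (\<Union>c\<in>C. ball c (\<epsilon> / 2))"
  proof (rule compactE_image[OF assms(1), of UNIV "\<lambda>c. ball c (\<epsilon> / 2)"])
    show "UNIV \<subseteq> (\<Union>c::'a. ball c (\<epsilon> / 2))" using assms(2) by (auto intro: exI[of _ "_::'a"])
  qed auto
  obtain h where h: "bij_betw h {0..<card C} C"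
    using ex_bij_betw_nat_finite[OF C(1)] by blast
  define u where "u x = (LEAST i. x \<in> ball (h i) (\<epsilon> / 2))" for x
  have ex: "\<exists>i<card C. x \<in> ball (h i) (\<epsilon> / 2)" for x
  proof -
    obtain c where "c \<in> C" "x \<in> ball c (\<epsilon> / 2)" using C(2) by blast
    moreover from this have "c \<in> h ` {0..<card C}" using h by (simp add: bij_betw_def)
    ultimately show ?thesis by auto
  qed
  have in_ball: "x \<in> ball (h (u x)) (\<epsilon> / 2)" for x
    unfolding u_def using ex[of x] by (auto intro: LeastI)
  show thesis
  proof
    show "u \<in> borel \<rightarrow>\<^sub>M count_space UNIV"
    proof -
      have "Measurable.pred borel (\<lambda>x. x \<in> ball (h i) (\<epsilon> / 2))" for i
        unfolding pred_def using borel_open[OF open_ball[of "h i" "\<epsilon> / 2"]]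
        by (simp only: space_borel UNIV_I simp_thms Collect_mem_eq)
      then show ?thesis unfolding u_def by (intro measurable_Least)
    qed
    show "u x < card C" for x
    proof -
      obtain i where i: "i < card C" "x \<in> ball (h i) (\<epsilon> / 2)" using ex by blast
      have "u x \<le> i" unfolding u_def by (rule Least_le) (rule i(2))
      then show ?thesis using i(1) by simp
    qed
    show "dist x y < \<epsilon>" if eq: "u x = u y" for x y
    proof (rule dist_triangle_half_r)
      show "dist (h (u x)) x < \<epsilon> / 2" using in_ball[of x] by simp
      show "dist (h (u x)) y < \<epsilon> / 2" using in_ball[of y] by (simp add: eq)
    qed
  qed
qed

text \<open>Code lengths in base e subject to Kraft's inequality. They are integer valued and
  extensional on a finite set of words, which leaves only countably many codes.\<close>

definition codes :: "nat \<Rightarrow> nat \<Rightarrow> (nat list \<Rightarrow> nat) set" where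
  "codes k m = {L \<in> words k m \<rightarrow>\<^sub>E UNIV. (\<Sum>w\<in>words k m. exp (- real (L w))) \<le> 1}"

lemma countable_codes: "countable (codes k m)"
  unfolding codes_def by (rule countable_subset[OF _ countable_PiE[of "words k m" "\<lambda>_. UNIV"]]) auto

text \<open>Each block split off contributes its Kraft sum, a factor at most 1. Fewer than
  \<open>m\<close> symbols remain at the end and are summed uncoded, whence the power of the
  alphabet size; \<open>max 1 k\<close> keeps powers increasing even for
  \<open>k = 0\<close>.\<close>

lemma sum_aligned_blocks_le:
  fixes L :: "nat list \<Rightarrow> nat"
  assumes "0 < m" and kraft: "(\<Sum>w\<in>words k m. exp (- real (L w))) \<le> 1"
  shows "(\<Sum>w\<in>words k n. exp (- (\<Sum>j<n div m. real (L (take m (drop (j * m) w)))))) \<le> (max 1 k) ^ m"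
proof (induction n rule: less_induct)
  case (less n)
  show ?case
  proof (cases "n < m")
    case True
    have "real k ^ n \<le> max 1 k ^ n" by (simp add: power_mono)
    also have "\<dots> \<le> max 1 k ^ m" using True by (intro of_nat_mono power_increasing) auto
    finally show ?thesis using True by (simp add: card_words)
  next
    case False
    define n' where "n' = n - m"
    have n: "n = m + n'" using False by (simp add: n'_def)
    let ?G = "\<lambda>v. exp (- (\<Sum>j<n' div m. real (L (take m (drop (j * m) v)))))"
    have "(\<Sum>w\<in>words k n. exp (- (\<Sum>j<n div m. real (L (take m (drop (j * m) w)))))) =
        (\<Sum>w\<in>words k (m + n'). exp (- real (L (take m w))) * ?G (drop m w))"
    proof (rule sum.cong)
      fix w
      have "n div m = Suc (n' div m)" using assms(1) by (simp add: n)
      then show "exp (- (\<Sum>j<n div m. real (L (take m (drop (j * m) w))))) =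
          exp (- real (L (take m w))) * ?G (drop m w)"
        by (simp add: sum.lessThan_Suc_shift exp_add[symmetric] add.commute del: sum.lessThan_Suc)
    qed (simp add: n)
    also have "\<dots> = (\<Sum>v\<in>words k m. exp (- real (L v))) * (\<Sum>v\<in>words k n'. ?G v)"
      by (rule sum_words_add)
    also have "\<dots> \<le> 1 * real ((max 1 k) ^ m)"
      using less[of n'] assms(1) by (intro mult_mono kraft) (auto simp: n intro: sum_nonneg)
    finally show ?thesis by simp
  qed
qed

text \<open>The starting positions \<open>r + j * m\<close> of aligned blocks are distinct for
  distinct pairs, and all of them start a complete window. There are \<open>n + 1 - m\<close>
  complete windows of length \<open>m\<close>; truncated subtraction gives none when
  \<open>n < m\<close>.\<close>

lemma sum_residue_classes_le:
  fixes a :: "nat \<Rightarrow> real"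
  assumes "0 < m" "\<And>i. 0 \<le> a i"
  shows "(\<Sum>r<m. \<Sum>j<(n - r) div m. a (r + j * m)) \<le> (\<Sum>i<n + 1 - m. a i)"
proof -
  let ?S = "SIGMA r:{..<m}. {..<(n - r) div m}" and ?g = "\<lambda>(r, j). r + j * m"
  have inj: "inj_on ?g ?S"
  proof (rule inj_onI, clarsimp)
    fix r j r' j' assume "r < m" "r' < m" and eq: "r + j * m = r' + j' * m"
    have "(r + j * m) mod m = (r' + j' * m) mod m" by (simp only: eq)
    then have "r = r'" using \<open>r < m\<close> \<open>r' < m\<close> by simp
    then show "r = r' \<and> j = j'" using eq assms(1) by simp
  qed
  have sub: "?g ` ?S \<subseteq> {..<n + 1 - m}"
  proof clarsimp
    fix r j assume "r < m" "j < (n - r) div m"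
    then have "(Suc j) * m \<le> n - r"
      using assms(1) by (metis Suc_leI less_eq_div_iff_mult_less_eq)
    then show "r + j * m < Suc n - m" using assms(1) by simp
  qed
  have "(\<Sum>r<m. \<Sum>j<(n - r) div m. a (r + j * m)) = (\<Sum>p\<in>?S. a (?g p))"
    by (simp add: sum.Sigma case_prod_unfold)
  also have "\<dots> = (\<Sum>i\<in>?g ` ?S. a i)" by (simp add: sum.reindex[OF inj])
  also have "\<dots> \<le> (\<Sum>i<n + 1 - m. a i)" using assms(2) sub by (intro sum_mono2) auto
  finally show ?thesis .
qed

text \<open>Birkhoff sums see windows at every position, while Kraft's inequality concerns disjoint
  blocks. Among the \<open>m\<close> phases of block parsing, one costs at most the window total
  divided by \<open>m\<close>, so summing over all phases bounds the left side. Each phase leaves an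
  uncoded head and tail, together at most \<open>2 * m\<close> symbols. The bound does not depend on
  \<open>n\<close>.\<close>

lemma sum_blocks_le:
  fixes L :: "nat list \<Rightarrow> nat"
  assumes "0 < m" and kraft: "(\<Sum>w\<in>words k m. exp (- real (L w))) \<le> 1"
  shows "(\<Sum>w\<in>words k n. exp (- (\<Sum>i<n + 1 - m. real (L (take m (drop i w)))) / m))
    \<le> m * (max 1 k) ^ (2 * m)"
proof -
  let ?Y = "\<lambda>r w. \<Sum>j<(n - r) div m. real (L (take m (drop (r + j * m) w)))"
  have 1: "exp (- (\<Sum>i<n + 1 - m. real (L (take m (drop i w)))) / m) \<le> (\<Sum>r<m. exp (- ?Y r w))" for w
  proof -
    let ?A = "\<Sum>i<n + 1 - m. real (L (take m (drop i w)))"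
    have "\<exists>r<m. ?Y r w \<le> ?A / m"
    proof (rule ccontr)
      assume "\<not> ?thesis"
      then have "(\<Sum>r<m. ?A / m) < (\<Sum>r<m. ?Y r w)"
        using assms(1) by (intro sum_strict_mono) auto
      then show False
        using sum_residue_classes_le[OF assms(1), of "\<lambda>i. real (L (take m (drop i w)))" n] assms(1) by simp
    qed
    then obtain r where r: "r < m" "?Y r w \<le> ?A / m" by blast
    then have "exp (- ?A / m) \<le> exp (- ?Y r w)" by simp
    also have "\<dots> \<le> (\<Sum>r<m. exp (- ?Y r w))"
      using r(1) by (intro member_le_sum) auto
    finally show ?thesis .
  qed
  have K: "real k ^ a \<le> max 1 k ^ m" if "a \<le> m" for a
  proof -
    have "real k ^ a \<le> max 1 k ^ a" by (simp add: power_mono)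
    also have "\<dots> \<le> max 1 k ^ m" using that by (intro of_nat_mono power_increasing) auto
    finally show ?thesis by simp
  qed
  have 2: "(\<Sum>w\<in>words k n. exp (- ?Y r w)) \<le> max 1 k ^ (2 * m)" if "r < m" for r
  proof (cases "r \<le> n")
    case True
    then have n: "n = r + (n - r)" by simp
    let ?G = "\<lambda>v. exp (- (\<Sum>j<(n - r) div m. real (L (take m (drop (j * m) v)))))"
    have "(\<Sum>w\<in>words k n. exp (- ?Y r w)) = (\<Sum>w\<in>words k (r + (n - r)). 1 * ?G (drop r w))"
      using True by (simp add: add.commute)
    also have "\<dots> = (\<Sum>v\<in>words k r. 1) * (\<Sum>v\<in>words k (n - r). ?G v)"
      by (rule sum_words_add)
    also have "\<dots> \<le> real (max 1 k ^ m) * real (max 1 k ^ m)"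
      using K[of r] that sum_aligned_blocks_le[OF assms, of "n - r"]
      by (intro mult_mono) (auto simp: card_words intro: sum_nonneg)
    finally show ?thesis by (simp add: mult_2 power_add)
  next
    case False
    then have "(\<Sum>w\<in>words k n. exp (- ?Y r w)) = real k ^ n" by (simp add: card_words)
    also have "\<dots> \<le> max 1 k ^ m" using False that by (intro K) simp
    also have "\<dots> \<le> max 1 k ^ (2 * m)" by (intro of_nat_mono power_increasing) auto
    finally show ?thesis by simp
  qed
  have "(\<Sum>w\<in>words k n. exp (- (\<Sum>i<n + 1 - m. real (L (take m (drop i w)))) / m)) \<le>
      (\<Sum>w\<in>words k n. \<Sum>r<m. exp (- ?Y r w))"
    by (intro sum_mono 1)
  also have "\<dots> = (\<Sum>r<m. \<Sum>w\<in>words k n. exp (- ?Y r w))" by (rule sum.swap)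
  also have "\<dots> \<le> (\<Sum>r<m. real (max 1 k ^ (2 * m)))" using 2 by (intro sum_mono) simp
  finally show ?thesis by simp
qed

section \<open>Points with compressible itineraries\<close>

lemma cover_limit_empty: "cover_limit f \<phi> {} \<alpha> \<epsilon> = 0"
  unfolding cover_limit_eq_0_iff
proof
  fix N
  show "cover_sum f \<phi> {} \<alpha> N \<epsilon> = 0"
    using cover_sum_le_finite[of "{}::nat set" "{}" f "\<lambda>_. 0" "\<lambda>_. undefined" \<epsilon> N \<phi> \<alpha>] by simp
qed

lemma cover_limit_countable_UN:
  assumes "countable C" "\<And>c. c \<in> C \<Longrightarrow> cover_limit f \<phi> (Z c) \<alpha> \<epsilon> = 0"
  shows "cover_limit f \<phi> (\<Union>c\<in>C. Z c) \<alpha> \<epsilon> = 0"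
proof (cases "C = {}")
  case False
  have "(\<Union>c\<in>C. Z c) = (\<Union>j. Z (from_nat_into C j))"
    using UN_from_nat_into[OF assms(1) False, of Z] by simp
  also have "cover_limit f \<phi> \<dots> \<alpha> \<epsilon> = 0"
    by (intro cover_limit_UN_eq_0 assms(2) from_nat_into False)
  finally show ?thesis .
qed (simp add: cover_limit_empty)

text \<open>A symbol away from the ends lies in \<open>m\<close> sliding windows, hence the division
  by \<open>m\<close>: Birkhoff averages of this function are a code rate plus an average of \<phi>,
  minus \<open>t\<close>.\<close>

definition code_excess ::
  "('a \<Rightarrow> 'a) \<Rightarrow> ('a \<Rightarrow> real) \<Rightarrow> ('a \<Rightarrow> nat) \<Rightarrow> real \<Rightarrow> nat \<Rightarrow> (nat list \<Rightarrow> nat) \<Rightarrow> 'a \<Rightarrow> real" where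
  "code_excess f \<phi> u t m L x = L (itinerary f u m x) / m + \<phi> x - t"

definition compressible_points ::
  "('a \<Rightarrow> 'a) \<Rightarrow> ('a \<Rightarrow> real) \<Rightarrow> ('a \<Rightarrow> nat) \<Rightarrow> real \<Rightarrow> nat \<Rightarrow> (nat list \<Rightarrow> nat) \<Rightarrow> 'a set" where
  "compressible_points f \<phi> u t m L =
     {x. \<forall>N. \<exists>n\<ge>N. birkhoff_sum f (code_excess f \<phi> u t m L) n x \<le> 0}"

text \<open>Points with the same itinerary of length \<open>n\<close> share a Bowen ball, so one
  centre per occurring word suffices. Choosing the centre inside the set makes its own Birkhoff sum
  of \<phi> at most \<open>n * t\<close> minus a code length, and \<open>sum_blocks_le\<close> sums
  over the words.\<close>

lemma code_cover_sum_le: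
  fixes L :: "nat list \<Rightarrow> nat"
  assumes label: "\<And>x. u x < k" "\<And>x y. u x = u y \<Longrightarrow> dist x y < \<epsilon>"
    and m: "0 < m" and kraft: "(\<Sum>w\<in>words k m. exp (- real (L w))) \<le> 1"
    and n: "0 < n" "N \<le> n"
  shows "cover_sum f \<phi> {x. birkhoff_sum f (code_excess f \<phi> u t m L) n x \<le> 0} \<alpha> N \<epsilon>
    \<le> ennreal (real (m * (max 1 k) ^ (2 * m)) * exp (- (\<alpha> - t)) ^ n)"
proof -
  let ?G = "{x. birkhoff_sum f (code_excess f \<phi> u t m L) n x \<le> 0}"
  define T where "T = itinerary f u n ` ?G"
  define c where "c w = (SOME x. x \<in> ?G \<and> itinerary f u n x = w)" for w
  have T: "T \<subseteq> words k n"
    unfolding T_def using itinerary_in_words[of u k, OF label(1)] by blast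
  then have "finite T" by (rule finite_subset) simp
  have c: "c w \<in> ?G" "itinerary f u n (c w) = w" if "w \<in> T" for w
    using someI_ex[of "\<lambda>x. x \<in> ?G \<and> itinerary f u n x = w"] that unfolding T_def c_def by blast+
  have "cover_sum f \<phi> ?G \<alpha> N \<epsilon> \<le> ennreal (\<Sum>w\<in>T. ball_weight f \<phi> \<alpha> n (c w))"
  proof (rule cover_sum_le_finite[OF \<open>finite T\<close>])
    show "?G \<subseteq> (\<Union>w\<in>T. bowen_ball f n (c w) \<epsilon>)"
    proof
      fix x assume x: "x \<in> ?G"
      let ?w = "itinerary f u n x"
      have w: "?w \<in> T" using x by (simp add: T_def)
      have "itinerary f u n (c ?w) = itinerary f u n x" by (rule c(2)[OF w])
      then have "x \<in> bowen_ball f n (c ?w) \<epsilon>"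
        using n(1) label(2) by (simp add: mem_bowen_ball_iff itinerary_eq_iff)
      then show "x \<in> (\<Union>w\<in>T. bowen_ball f n (c w) \<epsilon>)" using w by blast
    qed
  qed (rule n(2))
  also have "(\<Sum>w\<in>T. ball_weight f \<phi> \<alpha> n (c w)) \<le>
      (\<Sum>w\<in>T. exp (- (\<alpha> - t)) ^ n * exp (- (\<Sum>i<n + 1 - m. real (L (take m (drop i w)))) / m))"
  proof (rule sum_mono)
    fix w assume w: "w \<in> T"
    let ?x = "c w"
    have "birkhoff_sum f (code_excess f \<phi> u t m L) n ?x =
        (\<Sum>i<n. real (L (itinerary f u m ((f ^^ i) ?x)))) / m + birkhoff_sum f \<phi> n ?x - n * t"
      by (simp add: birkhoff_sum_def code_excess_def sum.distrib sum_subtractf sum_divide_distrib)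
    \<comment> \<open>The last windows run past the end of \<open>w\<close> and are not determined
      by it; lengths are nonnegative, so dropping them goes in the right direction.\<close>
    moreover have "(\<Sum>i<n + 1 - m. real (L (take m (drop i w)))) \<le> (\<Sum>i<n. real (L (itinerary f u m ((f ^^ i) ?x))))"
    proof -
      have "(\<Sum>i<n + 1 - m. real (L (take m (drop i w)))) = (\<Sum>i<n + 1 - m. real (L (itinerary f u m ((f ^^ i) ?x))))"
      proof (rule sum.cong)
        fix i assume "i \<in> {..<n + 1 - m}"
        then have "m \<le> n - i" by auto
        then have "take m (drop i (itinerary f u n ?x)) = itinerary f u m ((f ^^ i) ?x)"
          by (simp add: drop_itinerary take_itinerary)
        then show "real (L (take m (drop i w))) = L (itinerary f u m ((f ^^ i) ?x))"
          by (simp add: c(2)[OF w])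
      qed simp
      also have "\<dots> \<le> (\<Sum>i<n. real (L (itinerary f u m ((f ^^ i) ?x))))"
        using m by (intro sum_mono2) auto
      finally show ?thesis .
    qed
    ultimately have "birkhoff_sum f \<phi> n ?x \<le>
        n * t - (\<Sum>i<n + 1 - m. real (L (take m (drop i w)))) / m"
      using c(1)[OF w] m divide_right_mono[of "\<Sum>i<n + 1 - m. real (L (take m (drop i w)))" _ m] by fastforce
    then have "ball_weight f \<phi> \<alpha> n ?x \<le>
        exp (n * (- (\<alpha> - t)) + - (\<Sum>i<n + 1 - m. real (L (take m (drop i w)))) / m)"
      by (simp add: algebra_simps)
    then show "ball_weight f \<phi> \<alpha> n ?x \<le>
        exp (- (\<alpha> - t)) ^ n * exp (- (\<Sum>i<n + 1 - m. real (L (take m (drop i w)))) / m)"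
      by (simp only: exp_add exp_of_nat_mult)
  qed
  also have "\<dots> \<le> (\<Sum>w\<in>words k n.
      exp (- (\<alpha> - t)) ^ n * exp (- (\<Sum>i<n + 1 - m. real (L (take m (drop i w)))) / m))"
    using T by (intro sum_mono2) auto
  also have "\<dots> \<le> real (m * (max 1 k) ^ (2 * m)) * exp (- (\<alpha> - t)) ^ n"
    unfolding sum_distrib_left[symmetric]
    using sum_blocks_le[OF m kraft, of n] by (simp add: mult.commute mult_right_mono)
  finally show ?thesis by (simp add: ennreal_leI)
qed

text \<open>As in the Borel-Cantelli lemma, the set lies in the union of the \<open>?G n\<close>
  over \<open>n \<ge> n0\<close> for every \<open>n0\<close>. The corresponding covers cost a
  geometric tail of ratio \<open>exp (- (\<alpha> - t)) < 1\<close>, which tends to 0 as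
  \<open>n0\<close> grows while \<open>N\<close> stays fixed.\<close>

lemma cover_limit_compressible_points:
  fixes L :: "nat list \<Rightarrow> nat"
  assumes label: "\<And>x. u x < k" "\<And>x y. u x = u y \<Longrightarrow> dist x y < \<epsilon>"
    and m: "0 < m" and kraft: "(\<Sum>w\<in>words k m. exp (- real (L w))) \<le> 1"
    and \<alpha>: "t < \<alpha>"
  shows "cover_limit f \<phi> (compressible_points f \<phi> u t m L) \<alpha> \<epsilon> = 0"
  unfolding cover_limit_eq_0_iff
proof
  fix N
  let ?G = "\<lambda>n. {x. birkhoff_sum f (code_excess f \<phi> u t m L) n x \<le> 0}"
  let ?K = "real (m * (max 1 k) ^ (2 * m))"
  define r where "r = exp (- (\<alpha> - t))"
  have r: "0 < r" "r < 1" using \<alpha> by (auto simp: r_def)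
  have le: "cover_sum f \<phi> (compressible_points f \<phi> u t m L) \<alpha> N \<epsilon> \<le> ennreal (?K * r ^ n0 / (1 - r))"
    if n0: "N < n0" for n0
  proof -
    have "compressible_points f \<phi> u t m L \<subseteq> (\<Union>j. ?G (n0 + j))"
      unfolding compressible_points_def using le_Suc_ex by blast
    then have "cover_sum f \<phi> (compressible_points f \<phi> u t m L) \<alpha> N \<epsilon> \<le> cover_sum f \<phi> (\<Union>j. ?G (n0 + j)) \<alpha> N \<epsilon>"
      by (rule cover_sum_mono) auto
    also have "\<dots> \<le> (\<Sum>j. cover_sum f \<phi> (?G (n0 + j)) \<alpha> N \<epsilon>)" by (rule cover_sum_UN)
    also have "\<dots> \<le> (\<Sum>j. ennreal (?K * r ^ (n0 + j)))"
    proof (intro suminf_le)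
      fix j
      show "cover_sum f \<phi> (?G (n0 + j)) \<alpha> N \<epsilon> \<le> ennreal (?K * r ^ (n0 + j))"
        using code_cover_sum_le[of u k \<epsilon> m L "n0 + j" N f \<phi> t \<alpha>, OF label m kraft] n0
        by (simp add: r_def)
    qed auto
    also have "\<dots> = ennreal (?K * r ^ n0 / (1 - r))"
    proof (rule suminf_ennreal_eq)
      show "(\<lambda>j. ?K * r ^ (n0 + j)) sums (?K * r ^ n0 / (1 - r))"
        using sums_mult[OF geometric_sums, of r "?K * r ^ n0"] r by (simp add: power_add mult.assoc)
    qed (use r in simp)
    finally show ?thesis .
  qed
  have "(\<lambda>n0. ?K * r ^ n0 / (1 - r)) \<longlonglongrightarrow> ?K * 0 / (1 - r)"
    using r by (intro tendsto_intros LIMSEQ_realpow_zero) auto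
  then have "(\<lambda>n0. ennreal (?K * r ^ n0 / (1 - r))) \<longlonglongrightarrow> ennreal 0"
    by (intro tendsto_ennrealI) simp
  then have "cover_sum f \<phi> (compressible_points f \<phi> u t m L) \<alpha> N \<epsilon> \<le> ennreal 0"
    by (rule LIMSEQ_le_const) (use le in \<open>auto intro: exI[of _ "Suc N"]\<close>)
  then show "cover_sum f \<phi> (compressible_points f \<phi> u t m L) \<alpha> N \<epsilon> = 0" by simp
qed

definition low_pressure_points ::
  "('a \<Rightarrow> 'a) \<Rightarrow> ('a \<Rightarrow> real) \<Rightarrow> ('a \<Rightarrow> nat) \<Rightarrow> nat \<Rightarrow> real \<Rightarrow> 'a set" where
  "low_pressure_points f \<phi> u k t =
     (\<Union>(m, L)\<in>(SIGMA m:{0<..}. codes k m). compressible_points f \<phi> u t m L)"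

lemma countable_all_codes: "countable (SIGMA m:{0<..}. codes k m)"
  by (intro countable_SIGMA countable_codes) auto

lemma set_pressure_low_pressure_points:
  assumes label: "\<And>x. u x < k" "\<And>x y. u x = u y \<Longrightarrow> dist x y < \<epsilon>"
  shows "set_pressure_at f \<phi> (low_pressure_points f \<phi> u k t) \<epsilon> \<le> ereal t"
proof -
  have "set_pressure_at f \<phi> (low_pressure_points f \<phi> u k t) \<epsilon> \<le> ereal \<alpha>" if "t < \<alpha>" for \<alpha>
    unfolding low_pressure_points_def
    using cover_limit_compressible_points[of u k \<epsilon>, OF label] that
    by (intro set_pressure_at_le cover_limit_countable_UN countable_all_codes) (auto simp: codes_def)
  then show ?thesis
    by (metis ereal_dense2 ereal_less_eq(3) le_cases not_le ereal_le_real less_ereal.simps(1))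
qed

context labelled_system
begin

lemma measurable_birkhoff_sum [measurable]:
  assumes [measurable]: "\<psi> \<in> borel_measurable borel"
  shows "birkhoff_sum f \<psi> n \<in> borel_measurable borel"
proof -
  have "birkhoff_sum f \<psi> n = (\<lambda>x. \<Sum>i<n. \<psi> ((f ^^ i) x))" by (auto simp: birkhoff_sum_def)
  then show ?thesis by simp
qed

lemma measurable_code_excess [measurable]:
  assumes [measurable]: "\<phi> \<in> borel_measurable borel"
  shows "code_excess f \<phi> u t m L \<in> borel_measurable borel"
proof -
  have [measurable]: "(\<lambda>x. real (L (itinerary f u m x))) \<in> borel_measurable borel"
    by (rule measurable_compose[OF measurable_itinerary]) simp
  have "code_excess f \<phi> u t m L = (\<lambda>x. L (itinerary f u m x) / m + \<phi> x - t)"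
    by (auto simp: code_excess_def)
  then show ?thesis by simp
qed

lemma low_pressure_points_sets:
  assumes [measurable]: "\<phi> \<in> borel_measurable borel"
  shows "low_pressure_points f \<phi> u k t \<in> sets M"
proof -
  have "compressible_points f \<phi> u t m L \<in> sets borel" for m L
  proof -
    have "compressible_points f \<phi> u t m L =
        {x \<in> space borel. \<forall>N. \<exists>n\<in>{N..}. birkhoff_sum f (code_excess f \<phi> u t m L) n x \<le> 0}"
      by (auto simp: compressible_points_def)
    also have "\<dots> \<in> sets borel" by measurable
    finally show ?thesis .
  qed
  then show ?thesis
    unfolding low_pressure_points_def sets_M
    by (intro sets.countable_UN''[OF countable_all_codes]) auto
qed

text \<open>The code is Shannon's, with lengths \<open>-ln p\<close> rounded up; mixing with the uniform
  distribution keeps the lengths finite on words of probability zero.\<close>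

lemma shannon_code:
  obtains L where "L \<in> codes k m" "(\<integral>x. real (L (itinerary f u m x)) \<partial>M) \<le> word_entropy m + 2"
proof -
  let ?c = "real (card (words k m))"
  have ne: "words k m \<noteq> {}" using itinerary_in by blast
  then have c: "1 \<le> ?c" by (simp add: Suc_le_eq card_gt_0_iff)
  \<comment> \<open>Halving the mass costs \<open>ln 2 < 1\<close> in length and rounding up costs
    at most 1; together they give the \<open>2\<close> in the conclusion.\<close>
  define q where "q w = (word_prob m w + 1 / ?c) / 2" for w
  define L where "L = restrict (\<lambda>w. nat \<lceil>- ln (q w)\<rceil>) (words k m)"
  have q: "0 < q w" "q w \<le> 1" for w
  proof -
    have "word_prob m w \<le> 1" by (simp add: word_prob_def)
    moreover have "1 / ?c \<le> 1" using c by simp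
    ultimately show "q w \<le> 1" by (simp add: q_def)
    show "0 < q w" using c word_prob_nonneg[of m w] by (simp add: q_def add_nonneg_pos)
  qed
  have L: "- ln (q w) \<le> L w" "L w \<le> - ln (q w) + 1" if "w \<in> words k m" for w
  proof -
    have "ln (q w) \<le> 0" using q[of w] by simp
    then have "real (L w) = \<lceil>- ln (q w)\<rceil>" using that by (simp add: L_def)
    then show "- ln (q w) \<le> L w" "L w \<le> - ln (q w) + 1" by linarith+
  qed
  show thesis
  proof
    have "(\<Sum>w\<in>words k m. exp (- real (L w))) \<le> (\<Sum>w\<in>words k m. q w)"
    proof (rule sum_mono)
      fix w assume "w \<in> words k m"
      then have "exp (- real (L w)) \<le> exp (ln (q w))" using L(1)[of w] by simp
      then show "exp (- real (L w)) \<le> q w" using q(1)[of w] by simp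
    qed
    also have "\<dots> = 1"
      using ne by (simp add: q_def sum_divide_distrib[symmetric] sum.distrib sum_word_prob)
    finally show "L \<in> codes k m" by (simp add: codes_def L_def)
    have "(\<integral>x. real (L (itinerary f u m x)) \<partial>M) = (\<Sum>w\<in>words k m. word_prob m w * L w)"
      by (rule integral_itinerary)
    also have "\<dots> \<le> (\<Sum>w\<in>words k m. word_prob m w * (- ln (word_prob m w)) + 2 * word_prob m w)"
    proof (rule sum_mono)
      fix w assume w: "w \<in> words k m"
      show "word_prob m w * L w \<le> word_prob m w * (- ln (word_prob m w)) + 2 * word_prob m w"
      proof (cases "word_prob m w = 0")
        case False
        then have p: "0 < word_prob m w" using word_prob_nonneg[of m w] by linarith
        have "ln (word_prob m w) - ln 2 = ln (word_prob m w / 2)" using p by (simp add: ln_div)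
        also have "\<dots> \<le> ln (q w)"
        proof -
          have "word_prob m w / 2 \<le> q w" by (simp add: q_def)
          then show ?thesis using p q(1)[of w] by simp
        qed
        finally have "L w \<le> - ln (word_prob m w) + 2"
          using L(2)[OF w] ln_2_less_1 by linarith
        then have "word_prob m w * L w \<le> word_prob m w * (- ln (word_prob m w) + 2)"
          using p by (intro mult_left_mono) auto
        then show ?thesis by (simp add: algebra_simps)
      qed simp
    qed
    also have "\<dots> = word_entropy m + 2"
      by (simp add: word_entropy_def sum_subtractf sum_distrib_left[symmetric] sum_word_prob)
    finally show "(\<integral>x. real (L (itinerary f u m x)) \<partial>M) \<le> word_entropy m + 2" .
  qed
qed

text \<open>Shannon's code costs at most \<open>word_entropy m + 2\<close> on average, and dividing
  by a large \<open>m\<close> brings this close to \<open>label_entropy\<close>. The excess over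
  \<open>t\<close> then has negative mean, so its Birkhoff sums are eventually nonpositive almost
  everywhere.\<close>

lemma ergodic_low_pressure_points:
  assumes erg: "M \<in> ergodic_measures f"
    and [measurable]: "\<phi> \<in> borel_measurable borel" and int: "integrable M \<phi>"
    and t: "label_entropy + (\<integral>x. \<phi> x \<partial>M) < t"
  shows "emeasure M (low_pressure_points f \<phi> u k t) = 1"
proof -
  have "(\<lambda>m. word_entropy m / m + 2 * (1 / m)) \<longlonglongrightarrow> label_entropy + 2 * 0"
    by (intro tendsto_intros word_entropy_LIMSEQ lim_1_over_n)
  then have "\<forall>\<^sub>F m in sequentially. word_entropy m / m + 2 * (1 / m) < t - (\<integral>x. \<phi> x \<partial>M)"
    by (rule order_tendstoD) (use t in simp)
  then have "\<forall>\<^sub>F m in sequentially. 0 < m \<and> word_entropy m / m + 2 * (1 / m) < t - (\<integral>x. \<phi> x \<partial>M)"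
    using eventually_gt_at_top[of 0] by eventually_elim auto
  then obtain m where m: "0 < m" "word_entropy m / m + 2 * (1 / m) < t - (\<integral>x. \<phi> x \<partial>M)"
    by (auto simp: eventually_sequentially)
  obtain L where L: "L \<in> codes k m" "(\<integral>x. real (L (itinerary f u m x)) \<partial>M) \<le> word_entropy m + 2"
    by (rule shannon_code)
  let ?\<psi> = "code_excess f \<phi> u t m L"
  have intL: "integrable M (\<lambda>x. real (L (itinerary f u m x)))"
    by (rule integrable_itinerary)
  have eq: "?\<psi> = (\<lambda>x. real (L (itinerary f u m x)) / m + \<phi> x - t)"
    by (auto simp: code_excess_def)
  have int\<psi>: "integrable M ?\<psi>" unfolding eq using intL int by auto
  have "(\<integral>x. ?\<psi> x \<partial>M) = (\<integral>x. real (L (itinerary f u m x)) \<partial>M) / m + (\<integral>x. \<phi> x \<partial>M) - t"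
    unfolding eq using intL int prob_space by simp
  also have "\<dots> \<le> (word_entropy m + 2) / m + (\<integral>x. \<phi> x \<partial>M) - t"
    using L(2) m(1) by (simp add: divide_right_mono)
  also have "\<dots> < 0" using m by (simp add: add_divide_distrib)
  finally have "AE x in M. \<forall>\<^sub>F n in sequentially. birkhoff_sum f ?\<psi> n x \<le> 0"
    by (intro ergodic_birkhoff_sums_nonpos erg int\<psi>) auto
  then have "AE x in M. x \<in> low_pressure_points f \<phi> u k t"
  proof eventually_elim
    fix x assume "\<forall>\<^sub>F n in sequentially. birkhoff_sum f ?\<psi> n x \<le> 0"
    then have "x \<in> compressible_points f \<phi> u t m L"
      unfolding compressible_points_def eventually_sequentially by (auto intro: le_cases)
    then show "x \<in> low_pressure_points f \<phi> u k t"
      unfolding low_pressure_points_def using m(1) L(1) by auto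
  qed
  then show ?thesis
    using low_pressure_points_sets by (intro emeasure_eq_1_AE) auto
qed

end

section \<open>Entropy is bounded by the pressure\<close>

text \<open>Induction over the sigma-algebra generated by closed sets. A closed set is the
  intersection of its decreasing open \<open>1 / Suc n\<close> neighbourhoods, and complements
  exchange the roles of \<open>F\<close> and \<open>U\<close>.\<close>

lemma (in invariant_system) closed_open_regularity:
  assumes "A \<in> sets borel" "0 < e"
  shows "\<exists>F U. closed F \<and> open U \<and> F \<subseteq> A \<and> A \<subseteq> U \<and> measure M (U - F) < e"
proof -
  have "A \<in> sigma_sets UNIV (Collect closed)"
    using assms(1) by (simp add: borel_eq_closed)
  then show ?thesis using assms(2)
  proof (induction arbitrary: e)
    case (Basic A)
    show ?case
    proof (cases "A = {}")
      case False
      have A: "closed A" using Basic by simp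
      define U where "U n = {x. infdist x A < 1 / Suc n}" for n :: nat
      have open_U: "open (U n)" for n
        unfolding U_def by (intro open_Collect_less continuous_intros)
      have "decseq U"
        unfolding U_def decseq_def by (auto elim!: less_le_trans intro!: divide_left_mono)
      moreover have "(\<Inter>n. U n) = A"
      proof (intro equalityI subsetI)
        fix x assume "x \<in> (\<Inter>n. U n)"
        then have "infdist x A < 1 / Suc n" for n by (simp add: U_def)
        then have "infdist x A \<le> 0" using nat_approx_posE[of "infdist x A"] by (metis less_asym not_le)
        then show "x \<in> A"
          using in_closed_iff_infdist_zero[OF A False] infdist_nonneg[of x A] by simp
      qed (use False in \<open>simp add: U_def\<close>)
      ultimately have "(\<lambda>n. measure M (U n)) \<longlonglongrightarrow> measure M A"
        using finite_Lim_measure_decseq[of U] open_U by (simp add: sets_M image_subset_iff)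
      then have "\<forall>\<^sub>F n in sequentially. measure M (U n) < measure M A + e"
        by (rule order_tendstoD) (use Basic in simp)
      then obtain n where n: "measure M (U n) < measure M A + e"
        by (auto simp: eventually_sequentially)
      have "A \<subseteq> U n" using \<open>(\<Inter>n. U n) = A\<close> by blast
      then have "measure M (U n - A) = measure M (U n) - measure M A"
        using open_U A by (intro finite_measure_Diff) (auto simp: sets_M)
      then show ?thesis using n A open_U \<open>A \<subseteq> U n\<close> by (intro exI[of _ A] exI[of _ "U n"]) auto
    next
      case True
      then have "closed {} \<and> open {} \<and> {} \<subseteq> A \<and> A \<subseteq> {} \<and> measure M ({} - {}) < e"
        using Basic(2) by simp
      then show ?thesis by blast
    qed
  next
    case Empty
    then show ?case using closed_empty open_empty by (metis Diff_cancel measure_empty subset_refl)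
  next
    case (Compl A)
    obtain F U where FU: "closed F" "open U" "F \<subseteq> A" "A \<subseteq> U" "measure M (U - F) < e"
      using Compl.IH[OF Compl.prems] by blast
    show ?case
    proof (intro exI conjI)
      show "closed (- U)" "open (- F)" using FU(1,2) by auto
      show "- U \<subseteq> UNIV - A" "UNIV - A \<subseteq> - F" using FU(3,4) by blast+
      have "- F - (- U) = U - F" by blast
      then show "measure M (- F - (- U)) < e" using FU(5) by (simp only:)
    qed
  next
    case (Union A)
    have "\<exists>F U. closed F \<and> open U \<and> F \<subseteq> A i \<and> A i \<subseteq> U \<and> measure M (U - F) < e / 2 * (1/2)^Suc i" for i
      using Union.prems by (intro Union.IH) auto
    then obtain F U where FU: "\<And>i. closed (F i)" "\<And>i. open (U i)" "\<And>i. F i \<subseteq> A i" "\<And>i. A i \<subseteq> U i"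
      "\<And>i. measure M (U i - F i) < e / 2 * (1/2)^Suc i"
      by metis
    have sums: "(\<lambda>i. e / 2 * (1/2)^Suc i) sums (e / 2)"
      using sums_mult[OF power_half_series, of "e / 2"] by simp
    have [measurable]: "F i \<in> sets M" "U i \<in> sets M" for i
      using FU(1,2) by (auto simp: sets_M)
    have summ: "summable (\<lambda>i. measure M (U i - F i))"
      using FU(5) by (intro summable_comparison_test'[OF sums_summable[OF sums], of 0]) (auto intro: less_imp_le)
    have "measure M ((\<Union>i. U i) - (\<Union>i. F i)) \<le> measure M (\<Union>i. U i - F i)"
      by (intro finite_measure_mono) auto
    also have "\<dots> \<le> (\<Sum>i. measure M (U i - F i))"
      using summ by (intro finite_measure_subadditive_countably) auto
    also have "\<dots> \<le> (\<Sum>i. e / 2 * (1/2)^Suc i)"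
      using FU(5) sums by (intro suminf_le summ sums_summable[OF sums]) (auto intro: less_imp_le)
    also have "\<dots> = e / 2" using sums by (rule sums_unique[symmetric])
    finally have lim: "measure M ((\<Union>i. U i) - (\<Union>i. F i)) < e" using Union.prems by simp
    \<comment> \<open>An infinite union of closed sets need not be closed; by continuity from above
      a finite part of it keeps the error below \<open>e\<close>.\<close>
    have "(\<lambda>n. measure M ((\<Union>i. U i) - (\<Union>i<n. F i))) \<longlonglongrightarrow> measure M (\<Inter>n. (\<Union>i. U i) - (\<Union>i<n. F i))"
      by (intro finite_Lim_measure_decseq) (auto simp: decseq_def)
    also have "(\<Inter>n. (\<Union>i. U i) - (\<Union>i<n. F i)) = (\<Union>i. U i) - (\<Union>i. F i)" by auto
    finally have "\<forall>\<^sub>F n in sequentially. measure M ((\<Union>i. U i) - (\<Union>i<n. F i)) < e"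
      by (rule order_tendstoD) (rule lim)
    then obtain n where n: "measure M ((\<Union>i. U i) - (\<Union>i<n. F i)) < e"
      by (auto simp: eventually_sequentially)
    have "closed (\<Union>i<n. F i)" "open (\<Union>i. U i)" using FU(1,2) by auto
    moreover have "(\<Union>i<n. F i) \<subseteq> (\<Union>i. A i)" "(\<Union>i. A i) \<subseteq> (\<Union>i. U i)"
      using FU(3,4) by blast+
    ultimately show ?case using n by blast
  qed
qed

lemma compact_closed_separation:
  fixes S T :: "'a::metric_space set"
  assumes "compact S" "closed T" "S \<inter> T = {}"
  shows "\<exists>d>0. \<forall>x\<in>S. \<forall>y\<in>T. d \<le> dist x y"
proof (cases "S = {} \<or> T = {}")
  case False
  have "continuous_on S (\<lambda>x. infdist x T)" by (intro continuous_intros)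
  then obtain x where x: "x \<in> S" "\<And>y. y \<in> S \<Longrightarrow> infdist x T \<le> infdist y T"
    using continuous_attains_inf[OF assms(1), of "\<lambda>x. infdist x T"] False by auto
  have "infdist x T \<noteq> 0"
    using in_closed_iff_infdist_zero[OF assms(2)] x(1) assms(3) False by blast
  then have "0 < infdist x T" using infdist_nonneg[of x T] by linarith
  moreover have "infdist x T \<le> dist y z" if "y \<in> S" "z \<in> T" for y z
    using x(2)[OF that(1)] infdist_le[OF that(2), of y] by linarith
  ultimately show ?thesis by blast
qed (auto intro: exI[of _ 1])

lemma finite_disjoint_compact_separation:
  fixes K :: "nat \<Rightarrow> 'a::metric_space set"
  assumes "\<And>i. i < k \<Longrightarrow> compact (K i)" "\<And>i j. i < k \<Longrightarrow> j < k \<Longrightarrow> i \<noteq> j \<Longrightarrow> K i \<inter> K j = {}"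
  obtains d :: real where "0 < d"
    "\<And>i j x y. i < k \<Longrightarrow> j < k \<Longrightarrow> x \<in> K i \<Longrightarrow> y \<in> K j \<Longrightarrow> dist x y < d \<Longrightarrow> i = j"
proof -
  let ?I = "{(i, j). i < k \<and> j < k \<and> i \<noteq> j}"
  have fin: "finite ?I" by (rule finite_subset[of _ "{..<k} \<times> {..<k}"]) auto
  define sep where "sep p d \<longleftrightarrow> 0 < d \<and> (\<forall>x\<in>K (fst p). \<forall>y\<in>K (snd p). d \<le> dist x y)" for p d
  have "\<forall>p\<in>?I. \<exists>d. sep p d"
  proof
    fix p assume "p \<in> ?I"
    then obtain i j where p: "p = (i, j)" "i < k" "j < k" "i \<noteq> j" by auto
    have "\<exists>d>0. \<forall>x\<in>K i. \<forall>y\<in>K j. d \<le> dist x y"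
      using assms p by (intro compact_closed_separation) (simp_all add: compact_imp_closed)
    then show "\<exists>d. sep p d" by (simp add: sep_def p)
  qed
  then have "\<exists>d. \<forall>p\<in>?I. sep p (d p)" by (rule bchoice)
  then obtain d where "\<forall>p\<in>?I. sep p (d p)" by (rule exE)
  then have d: "\<And>p. p \<in> ?I \<Longrightarrow> 0 < d p"
    "\<And>p x y. p \<in> ?I \<Longrightarrow> x \<in> K (fst p) \<Longrightarrow> y \<in> K (snd p) \<Longrightarrow> d p \<le> dist x y"
    unfolding sep_def by auto
  show thesis
  proof
    \<comment> \<open>The inserted 1 keeps the minimum defined when there are no pairs to
      separate.\<close>
    show "0 < Min (insert 1 (d ` ?I))" using fin d(1) by (subst Min_gr_iff) auto
    fix i j x y
    assume *: "i < k" "j < k" "x \<in> K i" "y \<in> K j" "dist x y < Min (insert 1 (d ` ?I))"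
    show "i = j"
    proof (rule ccontr)
      assume "i \<noteq> j"
      then have p: "(i, j) \<in> ?I" using * by auto
      then have "Min (insert 1 (d ` ?I)) \<le> d (i, j)" using fin by (intro Min_le) auto
      then show False using d(2)[OF p, of x y] * by simp
    qed
  qed
qed

text \<open>Weight given to the symbol \<open>a\<close> when the centre of a ball predicts
  \<open>c\<close>. The reserve \<eta> is spread over the alphabet, so a wrong prediction costs the
  finite amount \<open>ln (k / \<eta>)\<close> and a correct one only
  \<open>- ln (1 - \<eta>)\<close>.\<close>

definition noise :: "nat \<Rightarrow> real \<Rightarrow> nat \<Rightarrow> nat \<Rightarrow> real" where
  "noise k \<eta> c a = (if a = c then 1 - \<eta> else \<eta> / k)"

text \<open>Each position carries total weight at most 1, whether or not the prediction
  \<open>c j\<close> belongs to the alphabet. The sequence \<open>c\<close> varies in the induction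
  because removing the first symbol shifts it.\<close>

lemma sum_noise_words_le:
  assumes "0 < \<eta>" "\<eta> < 1"
  shows "(\<Sum>w\<in>words k n. \<Prod>j<n. noise k \<eta> (c j) (w ! j)) \<le> 1"
proof (induction n arbitrary: c)
  case (Suc n)
  have one: "words k 1 = (\<lambda>a. [a]) ` {..<k}"
    by (auto simp: words_def length_Suc_conv)
  have "(\<Sum>v\<in>words k 1. noise k \<eta> (c 0) (v ! 0)) = (\<Sum>a<k. noise k \<eta> (c 0) a)"
    unfolding one by (subst sum.reindex) (auto simp: inj_on_def)
  also have "\<dots> \<le> (\<Sum>a<k. (if a = c 0 then 1 - \<eta> else 0) + \<eta> / k)"
    using assms by (intro sum_mono) (auto simp: noise_def)
  also have "\<dots> \<le> 1" using assms by (simp add: sum.distrib)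
  finally have first: "(\<Sum>v\<in>words k 1. noise k \<eta> (c 0) (v ! 0)) \<le> 1" .
  have "(\<Sum>w\<in>words k (Suc n). \<Prod>j<Suc n. noise k \<eta> (c j) (w ! j)) =
      (\<Sum>w\<in>words k (1 + n). noise k \<eta> (c 0) (take 1 w ! 0) * (\<Prod>j<n. noise k \<eta> (c (Suc j)) (drop 1 w ! j)))"
    by (intro sum.cong) (auto simp: words_def prod.lessThan_Suc_shift simp del: prod.lessThan_Suc)
  also have "\<dots> = (\<Sum>v\<in>words k 1. noise k \<eta> (c 0) (v ! 0)) *
      (\<Sum>w\<in>words k n. \<Prod>j<n. noise k \<eta> (c (Suc j)) (w ! j))"
    by (rule sum_words_add)
  also have "\<dots> \<le> 1 * 1"
    using assms by (intro mult_mono first Suc) (auto intro!: sum_nonneg prod_nonneg simp: noise_def)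
  finally show ?case by simp
qed simp

lemma birkhoff_sum_add:
  "birkhoff_sum f \<psi> (m + n) x = birkhoff_sum f \<psi> m x + birkhoff_sum f \<psi> n ((f ^^ m) x)"
  by (induction m arbitrary: x) (simp_all add: birkhoff_sum_Suc funpow_swap1, simp add: birkhoff_sum_def)

context labelled_system
begin

text \<open>The orbit is parsed into Bowen balls \<open>B i\<close> of length \<open>l i\<close> with centre labels \<open>c i\<close>;
  where no ball of the list applies, a single symbol is sent uncoded at cost \<open>C\<close>.
  Symbols that disagree with the centre label also cost at most \<open>C\<close>.\<close>

lemma parsing_code:
  fixes J :: "nat set" and l :: "nat \<Rightarrow> nat" and c :: "nat \<Rightarrow> nat \<Rightarrow> nat" and a :: "nat \<Rightarrow> real"
    and B :: "nat \<Rightarrow> 'a set" and \<beta> \<eta> C :: real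
  assumes J: "finite J" "\<And>i. i \<in> J \<Longrightarrow> 0 < l i" "\<And>i. i \<in> J \<Longrightarrow> l i \<le> lmax"
    and a: "\<And>i. i \<in> J \<Longrightarrow> 0 < a i" "(\<Sum>i\<in>J. a i) \<le> 1/2"
    and a_le: "\<And>i x. i \<in> J \<Longrightarrow> x \<in> B i \<Longrightarrow> - ln (a i) \<le> l i * \<beta> - birkhoff_sum f \<phi> (l i) x"
    and c: "\<And>i x j. i \<in> J \<Longrightarrow> x \<in> B i \<Longrightarrow> j < l i \<Longrightarrow> (f ^^ j) x \<notin> A0 \<Longrightarrow> c i j = u ((f ^^ j) x)"
    and \<eta>: "0 < \<eta>" "\<eta> \<le> 1/2"
    and C: "ln (k / \<eta>) \<le> C" "\<And>x. ln (2 * k) - \<beta> + \<phi> x \<le> C"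
  defines "g \<equiv> \<lambda>x. C * (indicator A0 x + indicator (- (\<Union>i\<in>J. B i)) x) - \<phi> x"
  shows "\<exists>q :: nat list \<Rightarrow> real. (\<forall>w. 0 < q w) \<and> (\<Sum>w\<in>words k n. q w) \<le> 1 \<and>
    (\<forall>x. - ln (q (itinerary f u n x)) \<le> n * (\<beta> - ln (1 - \<eta>)) + birkhoff_sum f g n x + C * real (min n lmax))"
proof (induction n rule: less_induct)
  case (less n)
  have k: "0 < k" using label_less[of undefined] by simp
  have C0: "0 \<le> C"
  proof -
    have "1 \<le> k / \<eta>" using k \<eta> by (simp add: field_simps)
    then have "0 \<le> ln (k / \<eta>)" by simp
    then show ?thesis using C(1) by simp
  qed
  have \<eta>ln: "ln (1 - \<eta>) \<le> 0" using \<eta> by simp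
  let ?G = "\<lambda>n x. n * (\<beta> - ln (1 - \<eta>)) + birkhoff_sum f g n x + C * real (min n lmax)"
  show ?case
  proof (cases "n = 0")
    case True
    then show ?thesis by (intro exI[of _ "\<lambda>_. 1"]) (simp add: birkhoff_sum_def)
  next
    case False
    define good where "good m q \<longleftrightarrow> (\<forall>w. 0 < q w) \<and> (\<Sum>w\<in>words k m. q w) \<le> 1 \<and>
      (\<forall>x. - ln (q (itinerary f u m x)) \<le> ?G m x)" for m and q :: "nat list \<Rightarrow> real"
    have "\<forall>m. \<exists>q. m < n \<longrightarrow> good m q" using less unfolding good_def by blast
    then have "\<exists>Q. \<forall>m. m < n \<longrightarrow> good m (Q m)" by (rule choice)
    then obtain Q :: "nat \<Rightarrow> nat list \<Rightarrow> real" where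
      Q: "\<And>m w. m < n \<Longrightarrow> 0 < Q m w" "\<And>m. m < n \<Longrightarrow> (\<Sum>w\<in>words k m. Q m w) \<le> 1"
        "\<And>m x. m < n \<Longrightarrow> - ln (Q m (itinerary f u m x)) \<le> ?G m x"
      unfolding good_def by blast
    let ?p = "\<lambda>i w. \<Prod>j<l i. noise k \<eta> (c i j) (w ! j)"
    \<comment> \<open>A ball longer than the remaining word does not fit and gets weight 0.
      Otherwise the weight of the ball is followed by the noisy prediction of its labels and by the
      code already built for the rest.\<close>
    let ?t = "\<lambda>i w. if l i \<le> n then a i * (?p i (take (l i) w) * Q (n - l i) (drop (l i) w)) else 0"
    \<comment> \<open>The \<open>k\<close> uncoded symbols share the half of the mass that the
      weights \<open>a i\<close> leave free.\<close>
    define b where "b = 1 / (2 * real k)"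
    have b: "0 < b" using k by (simp add: b_def)
    define q where "q w = (\<Sum>i\<in>J. ?t i w) + b * Q (n - 1) (drop 1 w)" for w
    have noise_pos: "0 < noise k \<eta> c' a'" for c' a'
      using \<eta> k by (simp add: noise_def)
    then have noise_ne: "noise k \<eta> c' a' \<noteq> 0" for c' a' by (metis less_irrefl)
    have t_nonneg: "0 \<le> ?t i w" if "i \<in> J" for i w
      using that a(1)[OF that] J(2)[OF that] Q(1)[of "n - l i"] noise_pos False
      by (auto intro!: mult_nonneg_nonneg prod_nonneg intro: less_imp_le)
    have q_pos: "0 < q w" for w
      unfolding q_def using t_nonneg b Q(1)[of "n - 1"] False by (intro add_nonneg_pos sum_nonneg) auto
    have "(\<Sum>w\<in>words k n. q w) = (\<Sum>i\<in>J. \<Sum>w\<in>words k n. ?t i w) + (\<Sum>w\<in>words k n. b * Q (n - 1) (drop 1 w))"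
      unfolding q_def sum.distrib by (subst sum.swap) simp
    also have "\<dots> \<le> (\<Sum>i\<in>J. a i) + 1 / 2"
    proof (intro add_mono sum_mono)
      fix i assume i: "i \<in> J"
      show "(\<Sum>w\<in>words k n. ?t i w) \<le> a i"
      proof (cases "l i \<le> n")
        case True
        have "(\<Sum>w\<in>words k n. ?t i w) =
            a i * (\<Sum>w\<in>words k (l i + (n - l i)). ?p i (take (l i) w) * Q (n - l i) (drop (l i) w))"
          using True by (simp add: sum_distrib_left)
        also have "\<dots> = a i * ((\<Sum>v\<in>words k (l i). ?p i v) * (\<Sum>v\<in>words k (n - l i). Q (n - l i) v))"
          by (subst sum_words_add) simp
        also have "\<dots> \<le> a i * (1 * 1)"
          using a(1)[OF i] \<eta> Q(2)[of "n - l i"] Q(1)[of "n - l i"] False J(2)[OF i]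
          by (intro mult_left_mono mult_mono sum_noise_words_le) (auto intro!: sum_nonneg intro: less_imp_le)
        finally show ?thesis by simp
      qed (use a(1)[OF i] in simp)
    next
      have "(\<Sum>w\<in>words k n. b * Q (n - 1) (drop 1 w)) =
          (\<Sum>w\<in>words k (1 + (n - 1)). b * Q (n - 1) (drop 1 w))" using False by simp
      also have "\<dots> = (\<Sum>v\<in>words k 1. b) * (\<Sum>v\<in>words k (n - 1). Q (n - 1) v)"
        by (rule sum_words_add)
      also have "\<dots> \<le> 1 / 2 * 1"
        using k Q(2)[of "n - 1"] Q(1)[of "n - 1"] False
        by (intro mult_mono) (auto simp: card_words b_def intro!: sum_nonneg intro: less_imp_le)
      finally show "(\<Sum>w\<in>words k n. b * Q (n - 1) (drop 1 w)) \<le> 1 / 2" by simp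
    qed
    also have "\<dots> \<le> 1" using a(2) by simp
    finally have q_sum: "(\<Sum>w\<in>words k n. q w) \<le> 1" .
    have cost: "- ln (q (itinerary f u n x)) \<le> ?G n x" for x
    proof (cases "\<exists>i\<in>J. l i \<le> n \<and> x \<in> B i")
      case True
      then obtain i where i: "i \<in> J" "l i \<le> n" "x \<in> B i" by blast
      let ?w = "itinerary f u n x" and ?y = "(f ^^ l i) x"
      have li: "n - l i < n" using J(2)[OF i(1)] False by simp
      have tk: "take (l i) ?w = itinerary f u (l i) x" "drop (l i) ?w = itinerary f u (n - l i) ?y"
        using i(2) by (simp_all add: take_itinerary drop_itinerary)
      have pos: "0 < ?p i (take (l i) ?w)" "0 < Q (n - l i) (drop (l i) ?w)"
        using noise_pos Q(1)[OF li] by (auto intro: prod_pos)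
      \<comment> \<open>A single summand bounds the mixture \<open>q\<close> from below; its
        negative logarithm splits into the price of the ball, of the label predictions and of the
        remaining word.\<close>
      have "a i * (?p i (take (l i) ?w) * Q (n - l i) (drop (l i) ?w)) = ?t i ?w" using i by simp
      also have "\<dots> \<le> (\<Sum>i\<in>J. ?t i ?w)" using i J(1) t_nonneg by (intro member_le_sum) auto
      also have "\<dots> \<le> q ?w"
        unfolding q_def using mult_pos_pos[OF b Q(1)[of "n - 1" "drop 1 ?w"]] False by simp
      finally have "ln (a i * (?p i (take (l i) ?w) * Q (n - l i) (drop (l i) ?w))) \<le> ln (q ?w)"
        using pos a(1)[OF i(1)] by (intro ln_mono) auto
      then have 1: "- ln (q ?w) \<le> - ln (a i) - ln (?p i (take (l i) ?w)) - ln (Q (n - l i) (drop (l i) ?w))"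
        using ln_mult_pos[OF a(1)[OF i(1)] mult_pos_pos[OF pos]] ln_mult_pos[OF pos] by linarith
      have 2: "- ln (?p i (take (l i) ?w)) \<le> (\<Sum>j<l i. - ln (1 - \<eta>) + C * indicator A0 ((f ^^ j) x))"
      proof -
        have "- ln (?p i (take (l i) ?w)) = (\<Sum>j<l i. - ln (noise k \<eta> (c i j) (take (l i) ?w ! j)))"
          using noise_ne by (subst ln_prod) (simp_all add: sum_negf)
        also have "\<dots> \<le> (\<Sum>j<l i. - ln (1 - \<eta>) + C * indicator A0 ((f ^^ j) x))"
        proof (rule sum_mono)
          fix j assume j: "j \<in> {..<l i}"
          then have w: "take (l i) ?w ! j = u ((f ^^ j) x)" unfolding tk by (simp add: nth_itinerary)
          show "- ln (noise k \<eta> (c i j) (take (l i) ?w ! j)) \<le> - ln (1 - \<eta>) + C * indicator A0 ((f ^^ j) x)"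
          proof (cases "c i j = u ((f ^^ j) x)")
            case True
            then show ?thesis using C0 by (simp add: w noise_def)
          next
            case neq: False
            then have "(f ^^ j) x \<in> A0" using c[OF i(1,3)] j by auto
            moreover have "- ln (\<eta> / k) = ln (k / \<eta>)" using \<eta> k by (simp add: ln_div)
            ultimately show ?thesis using neq C(1) \<eta>ln by (simp add: w noise_def)
          qed
        qed
        finally show ?thesis .
      qed
      have 3: "birkhoff_sum f \<phi> (l i) x = (\<Sum>j<l i. \<phi> ((f ^^ j) x))" by (simp add: birkhoff_sum_def)
      have 4: "(\<Sum>j<l i. - ln (1 - \<eta>) + C * indicator A0 ((f ^^ j) x)) - birkhoff_sum f \<phi> (l i) x
          \<le> l i * (- ln (1 - \<eta>)) + birkhoff_sum f g (l i) x"
      proof -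
        have "(\<Sum>j<l i. - ln (1 - \<eta>) + C * indicator A0 ((f ^^ j) x)) - (\<Sum>j<l i. \<phi> ((f ^^ j) x)) =
            (\<Sum>j<l i. - ln (1 - \<eta>) + (C * indicator A0 ((f ^^ j) x) - \<phi> ((f ^^ j) x)))"
          by (simp add: sum_subtractf[symmetric] algebra_simps)
        also have "\<dots> \<le> (\<Sum>j<l i. - ln (1 - \<eta>) + g ((f ^^ j) x))"
          unfolding g_def using C0 by (intro sum_mono add_left_mono diff_right_mono mult_left_mono) auto
        also have "\<dots> = l i * (- ln (1 - \<eta>)) + birkhoff_sum f g (l i) x"
          unfolding sum.distrib by (simp add: birkhoff_sum_def)
        finally show ?thesis by (simp add: 3)
      qed
      have 5: "C * real (min (n - l i) lmax) \<le> C * real (min n lmax)"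
        using C0 by (intro mult_left_mono) auto
      have 6: "birkhoff_sum f g n x = birkhoff_sum f g (l i) x + birkhoff_sum f g (n - l i) ?y"
        using birkhoff_sum_add[of f g "l i" "n - l i" x] i(2) by simp
      have 7: "real n = real (l i) + real (n - l i)" using i(2) by simp
      have 8: "- ln (Q (n - l i) (drop (l i) ?w)) \<le> ?G (n - l i) ?y" unfolding tk by (rule Q(3)[OF li])
      show ?thesis
        using 1 2 4 5 8 a_le[OF i(1,3)] unfolding 6 7 by (simp add: algebra_simps)
    next
      case none: False
      let ?w = "itinerary f u n x"
      have n1: "n - 1 < n" using False by simp
      have d: "drop 1 ?w = itinerary f u (n - 1) (f x)" by (simp add: drop_itinerary)
      have "b * Q (n - 1) (drop 1 ?w) \<le> q ?w"
        unfolding q_def using t_nonneg by (simp add: sum_nonneg)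
      then have "ln (b * Q (n - 1) (drop 1 ?w)) \<le> ln (q ?w)"
        using b Q(1)[OF n1] by (intro ln_mono) auto
      then have 1: "- ln (q ?w) \<le> - ln b - ln (Q (n - 1) (drop 1 ?w))"
        using b Q(1)[OF n1, of "drop 1 ?w"] by (simp add: ln_mult)
      have 2: "- ln b \<le> \<beta> - \<phi> x + C"
        using C(2)[of x] k by (simp add: b_def ln_div)
      have 3: "- ln (Q (n - 1) (drop 1 ?w)) \<le> ?G (n - 1) (f x)" unfolding d by (rule Q(3)[OF n1])
      \<comment> \<open>Two situations force an uncoded symbol. If \<open>x\<close> lies in no ball,
        the indicator in \<open>g\<close> pays \<open>C\<close>. If \<open>x\<close> lies only in
        balls that are too long, then \<open>n < lmax\<close>, and the end term
        \<open>C * min n lmax\<close> drops by exactly \<open>C\<close>.\<close>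
      have 4: "C + C * real (min (n - 1) lmax) \<le> C * (indicator A0 x + indicator (- (\<Union>i\<in>J. B i)) x) + C * real (min n lmax)"
      proof (cases "x \<in> (\<Union>i\<in>J. B i)")
        case True
        then obtain i where "i \<in> J" "x \<in> B i" by blast
        then have "n < lmax" using none J(3)[of i] by fastforce
        then have "C + C * real (min (n - 1) lmax) = C * real (min n lmax)" using False by (simp add: algebra_simps)
        then show ?thesis using C0 by simp
      next
        case False
        have "C * real (min (n - 1) lmax) \<le> C * real (min n lmax)" using C0 by (intro mult_left_mono) auto
        moreover have "C \<le> C * (indicator A0 x + indicator (- (\<Union>i\<in>J. B i)) x)"
          using C0 False by (simp add: algebra_simps)
        ultimately show ?thesis by linarith
      qed
      have 5: "birkhoff_sum f g n x = g x + birkhoff_sum f g (n - 1) (f x)"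
        using birkhoff_sum_Suc[of f g "n - 1" x] False by simp
      have 6: "real n = 1 + real (n - 1)" using False by simp
      have 7: "g x = C * (indicator A0 x + indicator (- (\<Union>i\<in>J. B i)) x) - \<phi> x"
        by (simp add: g_def)
      show ?thesis using 1 2 3 4 \<eta>ln unfolding 5 6 7 by (simp add: algebra_simps)
    qed
    show ?thesis using q_pos q_sum cost by blast
  qed
qed

text \<open>Each of four losses is kept below \<open>d\<close>: the variation of \<phi> on a Bowen
  ball, the noise in correct predictions, visits to the set \<open>A0\<close> of unpredictable
  labels, and visits to the set \<open>Bad\<close> outside the finitely many balls used. The
  expected code length per symbol then bounds the entropy.\<close>

lemma label_entropy_le_measure_pressure:
  assumes comp: "compact (UNIV :: 'a set)" and cont: "continuous_on UNIV \<phi>"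
  shows "ereal (label_entropy + (\<integral>x. \<phi> x \<partial>M)) \<le> measure_pressure f \<phi> M"
proof (rule ccontr)
  assume "\<not> ?thesis"
  then have "measure_pressure f \<phi> M < ereal (label_entropy + (\<integral>x. \<phi> x \<partial>M))" by simp
  then obtain \<alpha> where \<alpha>: "measure_pressure f \<phi> M < ereal \<alpha>" "\<alpha> < label_entropy + (\<integral>x. \<phi> x \<partial>M)"
    using ereal_dense2 by (metis less_ereal.simps(1))
  \<comment> \<open>Four units of the gap pay for the losses; the fifth keeps the contradiction
    strict.\<close>
  define d where "d = (label_entropy + (\<integral>x. \<phi> x \<partial>M) - \<alpha>) / 5"
  have d: "0 < d" using \<alpha>(2) by (simp add: d_def)
  have k: "0 < k" using label_less[of undefined] by simp
  obtain D where D: "\<bar>\<phi> x\<bar> \<le> D" for x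
    using compact_imp_bounded[OF compact_continuous_image[OF cont comp]] by (auto simp: bounded_iff)
  have [measurable]: "\<phi> \<in> borel_measurable borel"
    by (rule borel_measurable_continuous_onI[OF cont])
  have int\<phi>: "integrable M \<phi>"
    using D by (intro integrable_const_bound[where B = D]) auto
  define \<eta> where "\<eta> = min (1/2) (1 - exp (- d))"
  have \<eta>: "0 < \<eta>" "\<eta> \<le> 1/2"
  proof -
    show "0 < \<eta>" using d by (simp add: \<eta>_def)
    show "\<eta> \<le> 1/2" unfolding \<eta>_def by (rule min.cobounded1)
  qed
  have "exp (- d) \<le> 1 - \<eta>" by (simp add: \<eta>_def)
  then have \<eta>d: "- ln (1 - \<eta>) \<le> d" using \<eta> by (subst (asm) ln_ge_iff[symmetric]) auto
  define \<beta> where "\<beta> = \<alpha> + d"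
  \<comment> \<open>The last two entries are the costs that \<open>parsing_code\<close> requires;
    the 1 makes division by \<open>C\<close> harmless. \<open>C\<close> is fixed before
    \<open>A0\<close> and \<open>Bad\<close>, whose measures can then be kept within
    \<open>d / C\<close>.\<close>
  define C where "C = max 1 (max (ln (k / \<eta>)) (ln (2 * k) - \<beta> + D))"
  have C: "1 \<le> C" "ln (k / \<eta>) \<le> C" "ln (2 * k) - \<beta> + \<phi> x \<le> C" for x
    using D[of x] by (auto simp: C_def)
  have "\<exists>F. closed F \<and> F \<subseteq> u -` {i} \<and> measure M (u -` {i} - F) < d / (C * k)" for i
  proof -
    have "u -` {i} \<in> sets borel" using measurable_sets[OF label_measurable, of "{i}"] by simp
    then obtain F U where FU: "closed F" "open U" "F \<subseteq> u -` {i}" "u -` {i} \<subseteq> U" "measure M (U - F) < d / (C * k)"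
      using closed_open_regularity[of "u -` {i}" "d / (C * k)"] d C(1) k by auto
    have "measure M (u -` {i} - F) \<le> measure M (U - F)"
      using FU by (intro finite_measure_mono) (auto simp: sets_M)
    then show ?thesis using FU by (intro exI[of _ F]) auto
  qed
  then obtain K where K: "\<And>i. closed (K i)" "\<And>i. K i \<subseteq> u -` {i}" "\<And>i. measure M (u -` {i} - K i) < d / (C * k)"
    by metis
  have K_sets [measurable]: "K i \<in> sets borel" for i using K(1) by simp
  define A0 where "A0 = - (\<Union>i<k. K i)"
  have A0 [measurable]: "A0 \<in> sets borel" unfolding A0_def by measurable
  have "measure M A0 \<le> measure M (\<Union>i<k. u -` {i} - K i)"
  proof (rule finite_measure_mono)
    show "A0 \<subseteq> (\<Union>i<k. u -` {i} - K i)"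
      using label_less by (auto simp: A0_def)
    have "u -` {i} \<in> sets borel" for i
      using measurable_sets[OF label_measurable, of "{i}"] by simp
    then show "(\<Union>i<k. u -` {i} - K i) \<in> sets M" using K_sets by (auto simp: sets_M)
  qed
  also have "\<dots> \<le> (\<Sum>i<k. measure M (u -` {i} - K i))"
    using measurable_sets[OF label_measurable] K_sets
    by (intro finite_measure_subadditive_finite) (auto simp: sets_M)
  also have "\<dots> \<le> (\<Sum>i<k. d / (C * k))" using K(3) by (intro sum_mono) (simp add: less_imp_le)
  also have "\<dots> = d / C" using k by simp
  finally have A0_small: "C * measure M A0 \<le> d" using C(1) by (simp add: field_simps)
  obtain s where s: "0 < s"
    "\<And>i j x y. i < k \<Longrightarrow> j < k \<Longrightarrow> x \<in> K i \<Longrightarrow> y \<in> K j \<Longrightarrow> dist x y < s \<Longrightarrow> i = j"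
  proof (rule finite_disjoint_compact_separation[of k K])
    show "compact (K i)" for i
      using closed_Int_compact[OF K(1) comp, of i] by simp
    show "K i \<inter> K j = {}" if "i \<noteq> j" for i j using K(2)[of i] K(2)[of j] that by blast
  qed blast
  have "uniformly_continuous_on UNIV \<phi>" by (rule compact_uniformly_continuous[OF cont comp])
  then have "\<exists>r>0. \<forall>x\<in>UNIV. \<forall>y\<in>UNIV. dist y x < r \<longrightarrow> dist (\<phi> y) (\<phi> x) < d"
    using d unfolding uniformly_continuous_on_def by simp
  then obtain r where r: "0 < r" "\<And>x y. dist x y < r \<Longrightarrow> dist (\<phi> x) (\<phi> y) < d"
    by auto
  \<comment> \<open>Two points within \<open>s / 2\<close> of a common centre are less than
    \<open>s\<close> apart, hence cannot lie in different \<open>K i\<close>; \<open>r\<close>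
    controls the variation of \<phi>.\<close>
  define \<epsilon> where "\<epsilon> = min (s / 2) r"
  have \<epsilon>: "0 < \<epsilon>" using s(1) r(1) by (simp add: \<epsilon>_def)
  have "measure_pressure_at f \<phi> M \<epsilon> \<le> measure_pressure f \<phi> M"
    unfolding measure_pressure_eq_SUP using \<epsilon> by (intro SUP_upper) simp
  then have "measure_pressure_at f \<phi> M \<epsilon> < ereal \<alpha>" using \<alpha>(1) by (rule le_less_trans)
  then obtain Z where Z: "Z \<in> sets M" "emeasure M Z = 1" "set_pressure_at f \<phi> Z \<epsilon> < ereal \<alpha>"
    unfolding measure_pressure_at_def Inf_less_iff by blast
  \<comment> \<open>Level 1 makes every ball length positive, so that parsing always
    advances.\<close>
  have "cover_sum f \<phi> Z \<alpha> 1 \<epsilon> = 0"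
    using set_pressure_at_lessD[OF Z(3)] unfolding cover_limit_eq_0_iff by blast
  moreover have "0 < ennreal (1/2)" by (subst ennreal_less_zero_iff) simp
  ultimately have "cover_sum f \<phi> Z \<alpha> 1 \<epsilon> < ennreal (1/2)" by (simp only:)
  then obtain I :: "nat set" and l x where I: "Z \<subseteq> (\<Union>i\<in>I. bowen_ball f (l i) (x i) \<epsilon>)"
    "\<And>i. i \<in> I \<Longrightarrow> 1 \<le> l i" "(\<Sum>\<^sub>\<infinity>i\<in>I. ennreal (ball_weight f \<phi> \<alpha> (l i) (x i))) < ennreal (1/2)"
    by (rule cover_sum_lessE) blast
  let ?B = "\<lambda>i. bowen_ball f (l i) (x i) \<epsilon>" and ?J = "\<lambda>n. I \<inter> {..<n}"
  have B_sets: "?B i \<in> sets borel" if "i \<in> I" for i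
  proof -
    have "?B i = (\<Inter>j\<in>{..<l i}. {y. dist ((f ^^ j) (x i)) ((f ^^ j) y) < \<epsilon>})"
      using I(2)[OF that] by (auto simp: mem_bowen_ball_iff)
    also have "open \<dots>"
      by (intro open_INT ballI open_Collect_less continuous_intros
          continuous_on_funpow continuous_f) auto
    finally show ?thesis by simp
  qed
  have BJ_sets: "- (\<Union>i\<in>?J n. ?B i) \<in> sets borel" for n
    using B_sets by (intro borel_comp sets.finite_UN) auto
  have "(\<lambda>n. measure M (- (\<Union>i\<in>?J n. ?B i))) \<longlonglongrightarrow> measure M (\<Inter>n. - (\<Union>i\<in>?J n. ?B i))"
  proof (rule finite_Lim_measure_decseq)
    show "range (\<lambda>n. - (\<Union>i\<in>?J n. ?B i)) \<subseteq> sets M" using BJ_sets by (simp add: image_subset_iff sets_M)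
  qed (auto simp: decseq_def)
  also have "measure M (\<Inter>n. - (\<Union>i\<in>?J n. ?B i)) = 0"
  proof -
    have AE_Z: "AE x in M. x \<in> Z" using Z(1,2) by (simp add: AE_in_set_eq_1 measure_def)
    have "x \<notin> (\<Inter>n. - (\<Union>i\<in>?J n. ?B i))" if "x \<in> Z" for x
      using I(1) that by fastforce
    then have "AE x in M. x \<notin> (\<Inter>n. - (\<Union>i\<in>?J n. ?B i))" using AE_Z by (rule eventually_mono[rotated])
    moreover have "(\<Inter>n. - (\<Union>i\<in>?J n. ?B i)) \<in> sets M"
      unfolding sets_M by (intro sets.countable_INT'' BJ_sets) auto
    ultimately show ?thesis by (subst prob_eq_0) auto
  qed
  finally have "\<forall>\<^sub>F n in sequentially. measure M (- (\<Union>i\<in>?J n. ?B i)) < d / C"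
    by (rule order_tendstoD) (use d C(1) in simp)
  then obtain N where N: "measure M (- (\<Union>i\<in>?J N. ?B i)) < d / C"
    by (auto simp: eventually_sequentially)
  \<comment> \<open>Finitely many balls have bounded length, so the end effect
    \<open>C * lmax\<close> disappears after division by \<open>n\<close>.\<close>
  define J where "J = ?J N"
  define Bad where "Bad = - (\<Union>i\<in>J. ?B i)"
  have J: "finite J" "J \<subseteq> I" by (auto simp: J_def)
  have Bad [measurable]: "Bad \<in> sets borel" unfolding Bad_def J_def by (rule BJ_sets)
  have Bad_small: "C * measure M Bad \<le> d" using N C(1) by (simp add: Bad_def J_def field_simps)
  let ?a = "\<lambda>i. ball_weight f \<phi> \<alpha> (l i) (x i)"
  have "ennreal (\<Sum>i\<in>J. ?a i) = (\<Sum>i\<in>J. ennreal (?a i))" by (rule sum_ennreal[symmetric]) simp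
  also have "\<dots> \<le> (\<Sum>\<^sub>\<infinity>i\<in>I. ennreal (?a i))"
    using J by (subst nonneg_infsum_complete) (auto intro!: SUP_upper)
  also have "\<dots> < ennreal (1/2)" by (rule I(3))
  finally have "ennreal (\<Sum>i\<in>J. ?a i) < ennreal (1/2)" .
  then have a_sum: "(\<Sum>i\<in>J. ?a i) \<le> 1/2"
    by (subst (asm) ennreal_less_iff) (simp_all add: sum_nonneg)
  \<comment> \<open>The label that a centre predicts at position \<open>z\<close>: the index of a
    compact piece within \<epsilon> of \<open>z\<close>. The separation \<open>s\<close> makes it
    unique whenever it exists.\<close>
  define lab where "lab z = (SOME i. i < k \<and> (\<exists>y\<in>K i. dist z y < \<epsilon>))" for z
  have lab: "lab z = u y" if y: "y \<notin> A0" "dist z y < \<epsilon>" for z y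
  proof -
    obtain i where i: "i < k" "y \<in> K i" using y(1) by (auto simp: A0_def)
    then have ui: "u y = i" using K(2) by auto
    have "lab z < k \<and> (\<exists>y\<in>K (lab z). dist z y < \<epsilon>)"
      unfolding lab_def by (rule someI[of _ i]) (use i y(2) in auto)
    then obtain y' where y': "lab z < k" "y' \<in> K (lab z)" "dist z y' < \<epsilon>" by blast
    have "dist y' y < s"
      using dist_triangle[of y' y z] y(2) y'(3) by (simp add: dist_commute \<epsilon>_def)
    then show ?thesis using s(2)[OF y'(1) i(1) y'(2) i(2)] ui by simp
  qed
  define g where "g = (\<lambda>x. C * (indicator A0 x + indicator Bad x) - \<phi> x)"
  have g_int: "integrable M g"
    unfolding g_def using int\<phi> by (intro Bochner_Integration.integrable_diff integrable_mult_right
        Bochner_Integration.integrable_add integrable_real_indicator) (auto simp: sets_M less_top[symmetric])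
  have g_integral: "(\<integral>x. g x \<partial>M) \<le> 2 * d - (\<integral>x. \<phi> x \<partial>M)"
  proof -
    have "(\<integral>x. g x \<partial>M) = C * (measure M A0 + measure M Bad) - (\<integral>x. \<phi> x \<partial>M)"
      unfolding g_def using int\<phi>
      by (subst Bochner_Integration.integral_diff)
        (auto simp: sets_M less_top[symmetric] intro!: Bochner_Integration.integrable_add)
    then show ?thesis using A0_small Bad_small by (simp add: distrib_left)
  qed
  define lmax where "lmax = Max (insert 0 (l ` J))"
  let ?e = "\<beta> - ln (1 - \<eta>)"
  have code: "\<exists>q :: nat list \<Rightarrow> real. (\<forall>w. 0 < q w) \<and> (\<Sum>w\<in>words k n. q w) \<le> 1 \<and>
    (\<forall>y. - ln (q (itinerary f u n y)) \<le> n * ?e + birkhoff_sum f g n y + C * real (min n lmax))" for n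
    unfolding g_def Bad_def
  proof (rule parsing_code[where a = ?a and c = "\<lambda>i j. lab ((f ^^ j) (x i))"])
    show "finite J" by (rule J(1))
    show "0 < l i" if "i \<in> J" for i using I(2)[of i] J(2) that by auto
    show "l i \<le> lmax" if "i \<in> J" for i unfolding lmax_def using J(1) that by (intro Max_ge) auto
    show "- ln (?a i) \<le> l i * \<beta> - birkhoff_sum f \<phi> (l i) y" if "i \<in> J" "y \<in> ?B i" for i y
    proof -
      have l: "0 < l i" using I(2)[of i] J(2) that by auto
      have "birkhoff_sum f \<phi> (l i) y \<le> (\<Sum>j<l i. \<phi> ((f ^^ j) (x i)) + d)"
        unfolding birkhoff_sum_def
      proof (rule sum_mono)
        fix j assume "j \<in> {..<l i}"
        then have "dist ((f ^^ j) (x i)) ((f ^^ j) y) < r"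
          using that(2) l by (auto simp: mem_bowen_ball_iff \<epsilon>_def)
        then show "\<phi> ((f ^^ j) y) \<le> \<phi> ((f ^^ j) (x i)) + d"
          using r(2) by (force simp: dist_real_def)
      qed
      also have "\<dots> = birkhoff_sum f \<phi> (l i) (x i) + l i * d"
        by (simp add: birkhoff_sum_def sum.distrib)
      finally show ?thesis by (simp add: \<beta>_def algebra_simps)
    qed
    show "lab ((f ^^ j) (x i)) = u ((f ^^ j) y)"
      if "i \<in> J" "y \<in> ?B i" "j < l i" "(f ^^ j) y \<notin> A0" for i y j
      using that by (intro lab) (auto simp: mem_bowen_ball_iff)
  qed (use a_sum \<eta> C in auto)
  have entropy: "word_entropy n / n \<le> ?e + (\<integral>y. g y \<partial>M) + C * lmax / n" if n: "0 < n" for n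
  proof -
    obtain q :: "nat list \<Rightarrow> real" where q: "\<And>w. 0 < q w" "(\<Sum>w\<in>words k n. q w) \<le> 1"
      "\<And>y. - ln (q (itinerary f u n y)) \<le> n * ?e + birkhoff_sum f g n y + C * real (min n lmax)"
      using code[of n] by blast
    have intS: "integrable M (birkhoff_sum f g n)"
      unfolding birkhoff_sum_def[abs_def] using g_int by (intro Bochner_Integration.integrable_sum integrable_funpow)
    have [measurable]: "g \<in> borel_measurable borel" unfolding g_def by measurable
    have "(\<integral>y. birkhoff_sum f g n y \<partial>M) = (\<Sum>i<n. \<integral>y. g ((f ^^ i) y) \<partial>M)"
      unfolding birkhoff_sum_def by (intro Bochner_Integration.integral_sum integrable_funpow g_int)
    also have "\<dots> = n * (\<integral>y. g y \<partial>M)" by (simp add: integral_funpow)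
    finally have S: "(\<integral>y. birkhoff_sum f g n y \<partial>M) = n * (\<integral>y. g y \<partial>M)" .
    have "word_entropy n \<le> (\<integral>y. n * ?e + birkhoff_sum f g n y + C * real (min n lmax) \<partial>M)"
      using q intS by (intro word_entropy_le[of n q]) (auto intro: less_imp_le)
    also have "\<dots> = n * ?e + n * (\<integral>y. g y \<partial>M) + C * real (min n lmax)"
      using intS prob_space by (simp add: S)
    also have "\<dots> \<le> n * ?e + n * (\<integral>y. g y \<partial>M) + C * lmax"
      using C(1) by (intro add_left_mono mult_left_mono) auto
    also have "\<dots> = n * (?e + (\<integral>y. g y \<partial>M) + C * lmax / n)"
      using n by (simp add: distrib_left)
    finally show ?thesis using n by (simp add: pos_divide_le_eq mult.commute)
  qed
  have "label_entropy \<le> ?e + (\<integral>y. g y \<partial>M) + C * lmax * 0"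
  proof (rule LIMSEQ_le[OF word_entropy_LIMSEQ])
    show "(\<lambda>n. ?e + (\<integral>y. g y \<partial>M) + C * lmax * (1 / n)) \<longlonglongrightarrow> ?e + (\<integral>y. g y \<partial>M) + C * lmax * 0"
      by (intro tendsto_intros lim_1_over_n)
    show "\<exists>N. \<forall>n\<ge>N. word_entropy n / n \<le> ?e + (\<integral>y. g y \<partial>M) + C * lmax * (1 / n)"
      using entropy by (intro exI[of _ 1]) auto
  qed
  also have "\<dots> \<le> \<alpha> + 4 * d - (\<integral>x. \<phi> x \<partial>M)"
    using g_integral \<eta>d by (simp add: \<beta>_def)
  also have "\<dots> < label_entropy" using d by (simp add: d_def field_simps)
  finally show False by simp
qed

end

section \<open>Ergodic decompositions\<close>

text \<open>The integral is finite and can change sides before the supremum over labellings is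
  taken.\<close>

lemma (in invariant_system) KS_entropy_le_measure_pressure:
  assumes "compact (UNIV :: 'a set)" "continuous_on UNIV \<phi>"
  shows "KS_entropy f M + ereal (\<integral>x. \<phi> x \<partial>M) \<le> measure_pressure f \<phi> M"
proof -
  have "KS_entropy f M \<le> measure_pressure f \<phi> M - ereal (\<integral>x. \<phi> x \<partial>M)"
  proof (rule KS_entropy_leI)
    fix u k assume "labelled_system f M u k"
    then interpret labelled_system f M u k .
    show "ereal label_entropy \<le> measure_pressure f \<phi> M - ereal (\<integral>x. \<phi> x \<partial>M)"
      using label_entropy_le_measure_pressure[OF assms] by (simp add: ereal_le_minus)
  qed
  then show ?thesis by (simp add: ereal_le_minus)
qed

text \<open>One sequence of labellings is fixed independently of any measure. Countability of the
  scales is used both for combining null sets and for measurability of the pressure.\<close>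

locale small_labellings =
  fixes f :: "'a::metric_space \<Rightarrow> 'a" and \<phi> :: "'a \<Rightarrow> real"
    and u :: "nat \<Rightarrow> 'a \<Rightarrow> nat" and k :: "nat \<Rightarrow> nat"
  assumes compact_space: "compact (UNIV :: 'a set)"
    and continuous: "continuous_on UNIV f" and potential: "continuous_on UNIV \<phi>"
    and label_measurable: "u j \<in> borel \<rightarrow>\<^sub>M count_space UNIV"
    and label_less: "u j x < k j"
    and label_diameter: "u j x = u j y \<Longrightarrow> dist x y < 1 / Suc j"
begin

lemma labelled_systemI: "\<nu> \<in> invariant_measures f \<Longrightarrow> labelled_system f \<nu> (u j) (k j)"
  by unfold_locales (use continuous label_measurable label_less in auto)

lemma potential_measurable: "\<phi> \<in> borel_measurable borel"
  by (rule borel_measurable_continuous_onI[OF potential])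

lemma potential_integrable:
  assumes "\<nu> \<in> invariant_measures f"
  shows "integrable \<nu> \<phi>"
proof -
  interpret labelled_system f \<nu> "u 0" "k 0" by (rule labelled_systemI[OF assms])
  obtain D where "\<And>x. \<bar>\<phi> x\<bar> \<le> D"
    using compact_imp_bounded[OF compact_continuous_image[OF potential compact_space]]
    by (auto simp: bounded_iff)
  then show ?thesis
    using potential_measurable by (intro integrable_const_bound[where B = D]) (auto simp: measurable_cong_sets[OF sets_M refl])
qed

text \<open>Stated with \<open>entropy_wrt\<close> because the measure varies here, whereas
  \<open>label_entropy\<close> belongs to a locale with a fixed measure.\<close>

abbreviation free_energy :: "'a measure \<Rightarrow> nat \<Rightarrow> real" where
  "free_energy \<nu> j \<equiv> entropy_wrt f \<nu> (label_partition (u j) (k j)) + (\<integral>x. \<phi> x \<partial>\<nu>)"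

lemma free_energy_le:
  assumes "\<nu> \<in> invariant_measures f"
  shows "ereal (free_energy \<nu> j) \<le> KS_entropy f \<nu> + ereal (\<integral>x. \<phi> x \<partial>\<nu>)"
proof -
  interpret labelled_system f \<nu> "u j" "k j" by (rule labelled_systemI[OF assms])
  show ?thesis
    using add_mono[OF label_entropy_le_KS_entropy order_refl[of "ereal (\<integral>x. \<phi> x \<partial>\<nu>)"]]
    by (simp add: entropy_wrt_label_partition)
qed

lemma emeasure_low_pressure_points:
  assumes "\<nu> \<in> ergodic_measures f" "free_energy \<nu> j < t"
  shows "emeasure \<nu> (low_pressure_points f \<phi> (u j) (k j) t) = 1"
proof -
  have inv: "\<nu> \<in> invariant_measures f" using assms(1) by (simp add: ergodic_measures_def)
  interpret labelled_system f \<nu> "u j" "k j" by (rule labelled_systemI[OF inv])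
  show ?thesis
    using assms(2) by (intro ergodic_low_pressure_points assms(1) potential_measurable potential_integrable inv)
      (simp add: entropy_wrt_label_partition)
qed

lemma low_pressure_points_borel:
  assumes "\<nu> \<in> invariant_measures f"
  shows "low_pressure_points f \<phi> (u j) (k j) t \<in> sets \<nu>"
proof -
  interpret labelled_system f \<nu> "u j" "k j" by (rule labelled_systemI[OF assms])
  show ?thesis by (rule low_pressure_points_sets[OF potential_measurable])
qed

lemma measure_pressure_at_le_threshold:
  assumes "\<nu> \<in> invariant_measures f" "emeasure \<nu> (low_pressure_points f \<phi> (u j) (k j) t) = 1"
  shows "measure_pressure_at f \<phi> \<nu> (1 / Suc j) \<le> ereal t"
  by (rule order_trans[OF measure_pressure_at_le[OF low_pressure_points_borel[OF assms(1)] assms(2)]])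
    (rule set_pressure_low_pressure_points[of "u j" "k j" "1 / Suc j", OF label_less label_diameter])

text \<open>The three quantities are closed into a cycle of inequalities: compressible itineraries
  bound the pressure by the countable supremum, which is at most entropy plus integral, which the
  parsing code bounds by the pressure. The countable supremum later supplies measurability.\<close>

lemma ergodic_measure_pressure:
  assumes erg: "\<nu> \<in> ergodic_measures f"
  shows "measure_pressure f \<phi> \<nu> = (SUP j. ereal (free_energy \<nu> j))"
    and "measure_pressure f \<phi> \<nu> = KS_entropy f \<nu> + ereal (\<integral>x. \<phi> x \<partial>\<nu>)"
proof -
  have inv: "\<nu> \<in> invariant_measures f" using erg by (simp add: ergodic_measures_def)
  interpret invariant_system f \<nu> using continuous inv by unfold_locales
  have 1: "measure_pressure f \<phi> \<nu> \<le> (SUP j. ereal (free_energy \<nu> j))"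
  proof (rule measure_pressure_leI)
    fix j
    have "measure_pressure_at f \<phi> \<nu> (1 / Suc j) \<le> ereal (free_energy \<nu> j) + ereal e" if "0 < e" for e
      using measure_pressure_at_le_threshold[OF inv emeasure_low_pressure_points[OF erg, of j "free_energy \<nu> j + e"]] that
      by simp
    then have "measure_pressure_at f \<phi> \<nu> (1 / Suc j) \<le> ereal (free_energy \<nu> j)"
      by (rule ereal_le_epsilon2)
    also have "\<dots> \<le> (SUP j. ereal (free_energy \<nu> j))" by (rule SUP_upper) simp
    finally show "measure_pressure_at f \<phi> \<nu> (1 / Suc j) \<le> (SUP j. ereal (free_energy \<nu> j))" .
  qed
  have 2: "(SUP j. ereal (free_energy \<nu> j)) \<le> KS_entropy f \<nu> + ereal (\<integral>x. \<phi> x \<partial>\<nu>)"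
    by (intro SUP_least free_energy_le inv)
  have 3: "KS_entropy f \<nu> + ereal (\<integral>x. \<phi> x \<partial>\<nu>) \<le> measure_pressure f \<phi> \<nu>"
    by (rule KS_entropy_le_measure_pressure[OF compact_space potential])
  show "measure_pressure f \<phi> \<nu> = (SUP j. ereal (free_energy \<nu> j))"
    by (rule antisym[OF 1 order_trans[OF 2 3]])
  show "measure_pressure f \<phi> \<nu> = KS_entropy f \<nu> + ereal (\<integral>x. \<phi> x \<partial>\<nu>)"
    by (rule antisym[OF order_trans[OF 1 2] 3])
qed

end

section \<open>Measurability with respect to the weak-star Borel sets\<close>

lemma
  fixes f :: "'a::metric_space \<Rightarrow> 'a"
  shows space_weak_star_borel: "space (weak_star_borel f) = invariant_measures f"
    and weak_star_open_sets: "openin (weak_star_topology f) U \<Longrightarrow> U \<in> sets (weak_star_borel f)"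
proof -
  have "topspace (weak_star_topology f) \<subseteq> invariant_measures f"
    unfolding weak_star_topology_def topology_generated_by_topspace by auto
  then have sub: "{U. openin (weak_star_topology f) U} \<subseteq> Pow (invariant_measures f)"
    using openin_subset by blast
  show "space (weak_star_borel f) = invariant_measures f"
    unfolding weak_star_borel_def using sub by (rule space_measure_of)
  show "openin (weak_star_topology f) U \<Longrightarrow> U \<in> sets (weak_star_borel f)"
    unfolding weak_star_borel_def using sub by (simp add: sets_measure_of sigma_sets.Basic)
qed

lemma weak_star_measurable_integral:
  fixes \<psi> :: "'a::metric_space \<Rightarrow> real"
  assumes "continuous_on UNIV \<psi>"
  shows "(\<lambda>\<nu>. \<integral>x. \<psi> x \<partial>\<nu>) \<in> borel_measurable (weak_star_borel f)"
proof (rule borel_measurableI)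
  fix S :: "real set" assume "open S"
  then have "openin (weak_star_topology f) {\<nu> \<in> invariant_measures f. (\<integral>x. \<psi> x \<partial>\<nu>) \<in> S}"
    unfolding weak_star_topology_def using assms by (intro topology_generated_by_Basis) auto
  then have "{\<nu> \<in> invariant_measures f. (\<integral>x. \<psi> x \<partial>\<nu>) \<in> S} \<in> sets (weak_star_borel f)"
    by (rule weak_star_open_sets)
  also have "{\<nu> \<in> invariant_measures f. (\<integral>x. \<psi> x \<partial>\<nu>) \<in> S} =
      (\<lambda>\<nu>. \<integral>x. \<psi> x \<partial>\<nu>) -` S \<inter> space (weak_star_borel f)"
    by (auto simp: space_weak_star_borel)
  finally show "(\<lambda>\<nu>. \<integral>x. \<psi> x \<partial>\<nu>) -` S \<inter> space (weak_star_borel f) \<in> sets (weak_star_borel f)" .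
qed

lemma invariant_measuresD:
  assumes "\<nu> \<in> invariant_measures f"
  shows "prob_space \<nu>" "sets \<nu> = sets borel" "space \<nu> = UNIV"
  using assms sets_eq_imp_space_eq[of \<nu> borel] by (auto simp: invariant_measures_def)

text \<open>The indicator of a closed set is the pointwise limit of continuous functions with values
  between 0 and 1. The empty set is separate because \<open>infdist\<close> to it is 0 by
  convention.\<close>

lemma weak_star_measurable_measure_closed:
  fixes A :: "'a::metric_space set"
  assumes "closed A"
  shows "(\<lambda>\<nu>. measure \<nu> A) \<in> borel_measurable (weak_star_borel f)"
proof (cases "A = {}")
  case False
  define \<psi> where "\<psi> n x = max 0 (1 - real n * infdist x A)" for n x
  have cont: "continuous_on UNIV (\<psi> n)" for n
    unfolding \<psi>_def by (intro continuous_intros)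
  show ?thesis
  proof (rule borel_measurable_LIMSEQ_real)
    show "(\<lambda>\<nu>. \<integral>x. \<psi> n x \<partial>\<nu>) \<in> borel_measurable (weak_star_borel f)" for n
      by (rule weak_star_measurable_integral[OF cont])
    fix \<nu> assume "\<nu> \<in> space (weak_star_borel f)"
    then have \<nu>: "prob_space \<nu>" "sets \<nu> = sets borel" "space \<nu> = UNIV"
      using invariant_measuresD unfolding space_weak_star_borel by blast+
    interpret prob_space \<nu> by (rule \<nu>(1))
    have "(\<lambda>n. \<integral>x. \<psi> n x \<partial>\<nu>) \<longlonglongrightarrow> (\<integral>x. indicator A x \<partial>\<nu>)"
    proof (rule integral_dominated_convergence[where w = "\<lambda>_. 1"])
      show "indicator A \<in> borel_measurable \<nu>"
        using assms by (intro borel_measurable_indicator) (simp add: \<nu>(2))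
      show "\<psi> n \<in> borel_measurable \<nu>" for n
        using borel_measurable_continuous_onI[OF cont[of n]] measurable_cong_sets[OF \<nu>(2) refl] by blast
      show "AE x in \<nu>. (\<lambda>n. \<psi> n x) \<longlonglongrightarrow> indicator A x"
      proof (rule AE_I2)
        fix x
        show "(\<lambda>n. \<psi> n x) \<longlonglongrightarrow> indicator A x"
        proof (cases "x \<in> A")
          case True
          then show ?thesis by (simp add: \<psi>_def)
        next
          case x: False
          then have pos: "0 < infdist x A"
            using in_closed_iff_infdist_zero[OF assms False] infdist_nonneg[of x A] by (metis less_le)
          obtain n0 :: nat where n0: "1 / infdist x A < n0" using reals_Archimedean2 by blast
          have "\<psi> n x = 0" if "n0 \<le> n" for n
          proof -
            have "1 / infdist x A \<le> n" using n0 that by linarith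
            then show ?thesis using pos by (simp add: \<psi>_def field_simps)
          qed
          then show ?thesis using x
            by (intro tendsto_eventually) (auto simp: eventually_sequentially)
        qed
      qed
      show "AE x in \<nu>. norm (\<psi> n x) \<le> 1" for n
        by (intro AE_I2) (auto simp: \<psi>_def infdist_nonneg)
    qed simp
    then show "(\<lambda>n. \<integral>x. \<psi> n x \<partial>\<nu>) \<longlonglongrightarrow> measure \<nu> A"
      using \<nu>(3) by simp
  qed
qed simp

text \<open>Closed sets form a generator stable under intersection, and the property passes to
  complements and disjoint unions. On a set that is not Borel, \<open>measure\<close> is constantly
  0, so the statement holds for every \<open>A\<close>.\<close>

lemma weak_star_measurable_measure:
  fixes f :: "'a::metric_space \<Rightarrow> 'a"
  shows "(\<lambda>\<nu>. measure \<nu> A) \<in> borel_measurable (weak_star_borel f)"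
proof (cases "A \<in> sets borel")
  case True
  have "Int_stable (Collect closed :: 'a set set)" by (auto simp: Int_stable_def)
  moreover have "Collect closed \<subseteq> Pow (UNIV :: 'a set)" by simp
  moreover have "A \<in> sigma_sets UNIV (Collect closed)"
    using True by (simp add: borel_eq_closed)
  ultimately show ?thesis
  proof (induction rule: sigma_sets_induct_disjoint)
    case (basic A)
    then show ?case by (simp add: weak_star_measurable_measure_closed)
  next
    case (compl A)
    have A: "A \<in> sets borel" using compl(1) by (simp add: borel_eq_closed)
    have "measure \<nu> (UNIV - A) = 1 - measure \<nu> A" if "\<nu> \<in> space (weak_star_borel f)" for \<nu>
      using prob_space.prob_compl[of \<nu> A] invariant_measuresD[of \<nu> f] that A
      by (simp add: space_weak_star_borel)
    then show ?case using compl(2) by (subst measurable_cong[where g = "\<lambda>\<nu>. 1 - measure \<nu> A"]) auto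
  next
    case (union A)
    have A: "range A \<subseteq> sets borel" using union(2) by (simp add: borel_eq_closed)
    show ?case
    proof (rule borel_measurable_LIMSEQ_real)
      show "(\<lambda>\<nu>. \<Sum>i<n. measure \<nu> (A i)) \<in> borel_measurable (weak_star_borel f)" for n
        using union(3) by (intro borel_measurable_sum) auto
      fix \<nu> assume "\<nu> \<in> space (weak_star_borel f)"
      then have \<nu>: "prob_space \<nu>" "sets \<nu> = sets borel"
        using invariant_measuresD unfolding space_weak_star_borel by blast+
      interpret prob_space \<nu> by (rule \<nu>(1))
      have "(\<lambda>i. measure \<nu> (A i)) sums measure \<nu> (\<Union>i. A i)"
        using A union(1) by (intro finite_measure_UNION) (simp_all add: \<nu>(2))
      then show "(\<lambda>n. \<Sum>i<n. measure \<nu> (A i)) \<longlonglongrightarrow> measure \<nu> (\<Union>i. A i)"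
        by (simp add: sums_def)
    qed
  qed simp
next
  case False
  have "measure \<nu> A = 0" if "\<nu> \<in> space (weak_star_borel f)" for \<nu>
    using that False invariant_measuresD(2)[of \<nu> f]
    by (intro measure_notin_sets) (simp add: space_weak_star_borel)
  then show ?thesis by (subst measurable_cong[where g = "\<lambda>_. 0"]) auto
qed

text \<open>For real sequences \<open>lim\<close> has one fixed value wherever there is no
  convergence, so it preserves measurability for an arbitrary \<open>P\<close>.\<close>

lemma weak_star_measurable_entropy:
  "(\<lambda>\<nu>. entropy_wrt f \<nu> P) \<in> borel_measurable (weak_star_borel f)"
proof -
  note [measurable] = weak_star_measurable_measure
  have [measurable]: "(\<lambda>\<nu>. partition_entropy \<nu> Q) \<in> borel_measurable (weak_star_borel f)" for Q
    unfolding partition_entropy_def by measurable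
  show ?thesis unfolding entropy_wrt_def by measurable
qed

section \<open>Pressure of a measure and of its ergodic components\<close>

locale decomposed_system =
  small_labellings f \<phi> u k + invariant_system f \<mu>
  for f :: "'a::metric_space \<Rightarrow> 'a" and \<phi> u k \<mu> +
  fixes \<tau> :: "'a measure measure"
  assumes decomposition: "ergodic_decomposition f \<mu> \<tau>"
begin

abbreviation ergodic_restriction :: "'a measure measure" where
  "ergodic_restriction \<equiv> restrict_space \<tau> (ergodic_measures f)"

lemma tau_prob_space: "prob_space \<tau>"
  and sets_tau: "sets \<tau> = sets (weak_star_borel f)"
  and emeasure_ergodic: "emeasure \<tau> (ergodic_measures f) = 1"
  using decomposition by (auto simp: ergodic_decomposition_def)

lemma space_tau: "space \<tau> = invariant_measures f"
  using sets_eq_imp_space_eq[OF sets_tau] by (simp add: space_weak_star_borel)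

lemma ergodic_sets: "ergodic_measures f \<in> sets \<tau>"
  using emeasure_ergodic emeasure_notin_sets[of "ergodic_measures f" \<tau>] by auto

lemma ergodic_subset: "ergodic_measures f \<subseteq> space \<tau>"
  by (auto simp: space_tau ergodic_measures_def)

lemma AE_ergodic: "AE \<nu> in \<tau>. \<nu> \<in> ergodic_measures f"
proof -
  interpret T: prob_space \<tau> by (rule tau_prob_space)
  show ?thesis
    using emeasure_ergodic ergodic_sets by (simp add: T.AE_in_set_eq_1 measure_def)
qed

lemma AE_restriction_iff:
  "(AE \<nu> in ergodic_restriction. P \<nu>) \<longleftrightarrow> (AE \<nu> in \<tau>. \<nu> \<in> ergodic_measures f \<longrightarrow> P \<nu>)"
  by (rule AE_restrict_space_iff) (use ergodic_sets ergodic_subset in \<open>simp add: Int_absorb2\<close>)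

lemma space_restriction: "space ergodic_restriction = ergodic_measures f"
  using ergodic_subset by (auto simp: space_restrict_space)

lemma measurable_restriction:
  "g \<in> borel_measurable (weak_star_borel f) \<Longrightarrow> g \<in> borel_measurable ergodic_restriction"
  by (intro measurable_restrict_space1) (simp add: measurable_cong_sets[OF sets_tau refl])

text \<open>Applied to the indicator of \<open>Z\<close>, the decomposition makes
  \<open>measure \<mu> Z\<close> an average of numbers at most 1; the average is 1 exactly when
  almost all of them are. Both comparisons of the pressure of \<mu> with the essential supremum use
  this.\<close>

lemma full_measure_iff:
  assumes Z: "Z \<in> sets borel"
  shows "emeasure \<mu> Z = 1 \<longleftrightarrow> (AE \<nu> in ergodic_restriction. emeasure \<nu> Z = 1)"
proof -
  interpret T: prob_space \<tau> by (rule tau_prob_space)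
  let ?g = "\<lambda>\<nu>. indicator (ergodic_measures f) \<nu> * measure \<nu> Z"
  have [measurable]: "(\<lambda>\<nu>. measure \<nu> Z) \<in> borel_measurable \<tau>"
    using weak_star_measurable_measure measurable_cong_sets[OF sets_tau refl] by blast
  have [measurable]: "ergodic_measures f \<in> sets \<tau>" by (rule ergodic_sets)
  have bounds: "0 \<le> ?g \<nu>" "?g \<nu> \<le> 1" if "\<nu> \<in> space \<tau>" for \<nu>
    using that prob_space.prob_le_1[of \<nu> Z] invariant_measuresD(1)[of \<nu> f]
    by (auto simp: indicator_def space_tau)
  have int: "integrable \<tau> ?g"
    using bounds by (intro T.integrable_const_bound[where B = 1] AE_I2) auto
  have dec: "\<forall>\<psi> :: 'a \<Rightarrow> real. integrable \<mu> \<psi> \<longrightarrow>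
      integral\<^sup>L \<mu> \<psi> = (LINT \<nu>:ergodic_measures f|\<tau>. integral\<^sup>L \<nu> \<psi>)"
    using decomposition unfolding ergodic_decomposition_def by (elim conjE)
  have int_Z: "integrable \<mu> (indicator Z :: 'a \<Rightarrow> real)"
    using Z by (intro integrable_real_indicator) (auto simp: sets_M less_top[symmetric])
  have "integral\<^sup>L \<mu> (indicator Z :: 'a \<Rightarrow> real) =
      (LINT \<nu>:ergodic_measures f|\<tau>. integral\<^sup>L \<nu> (indicator Z :: 'a \<Rightarrow> real))"
    by (rule dec[rule_format, OF int_Z])
  also have "\<dots> = (\<integral>\<nu>. ?g \<nu> \<partial>\<tau>)"
    unfolding set_lebesgue_integral_def
  proof (rule Bochner_Integration.integral_cong)
    fix \<nu> assume "\<nu> \<in> space \<tau>"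
    then have "space \<nu> = UNIV" using invariant_measuresD(3) by (simp add: space_tau)
    then show "indicator (ergodic_measures f) \<nu> *\<^sub>R integral\<^sup>L \<nu> (indicator Z :: 'a \<Rightarrow> real) = ?g \<nu>" by simp
  qed simp
  finally have eq: "measure \<mu> Z = (\<integral>\<nu>. ?g \<nu> \<partial>\<tau>)" by simp
  have "emeasure \<mu> Z = 1 \<longleftrightarrow> (\<integral>\<nu>. 1 - ?g \<nu> \<partial>\<tau>) = 0"
    using int T.prob_space eq by (simp add: emeasure_eq_measure)
  also have "\<dots> \<longleftrightarrow> (AE \<nu> in \<tau>. 1 - ?g \<nu> = 0)"
    using int bounds by (intro integral_nonneg_eq_0_iff_AE AE_I2) auto
  also have "\<dots> \<longleftrightarrow> (AE \<nu> in \<tau>. \<nu> \<in> ergodic_measures f \<longrightarrow> emeasure \<nu> Z = 1)"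
  proof -
    \<comment> \<open>Off the ergodic measures the left side is false and the right side vacuously
      true; those \<nu> form a null set.\<close>
    have "1 - ?g \<nu> = 0 \<longleftrightarrow> (\<nu> \<in> ergodic_measures f \<longrightarrow> emeasure \<nu> Z = 1)" if "\<nu> \<in> ergodic_measures f" for \<nu>
    proof -
      interpret N: prob_space \<nu>
        using that invariant_measuresD(1) by (auto simp: ergodic_measures_def)
      show ?thesis using that by (simp add: N.emeasure_eq_measure)
    qed
    then show ?thesis by (intro eventually_subst eventually_mono[OF AE_ergodic])
  qed
  finally show ?thesis by (simp add: AE_restriction_iff)
qed

text \<open>The pressure is defined by an infimum over possibly uncountably many sets, which says
  nothing about measurability; on ergodic measures it is a supremum of countably many measurable
  functions.\<close>

lemma measurable_pressure: "measure_pressure f \<phi> \<in> borel_measurable ergodic_restriction"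
proof -
  have [measurable]: "(\<lambda>\<nu>. \<integral>x. \<phi> x \<partial>\<nu>) \<in> borel_measurable (weak_star_borel f)"
    by (rule weak_star_measurable_integral[OF potential])
  note [measurable] = weak_star_measurable_entropy
  have "(\<lambda>\<nu>. SUP j. ereal (free_energy \<nu> j)) \<in> borel_measurable (weak_star_borel f)"
    by measurable
  then have "(\<lambda>\<nu>. SUP j. ereal (free_energy \<nu> j)) \<in> borel_measurable ergodic_restriction"
    by (rule measurable_restriction)
  then show ?thesis
    by (subst measurable_cong) (simp_all add: space_restriction ergodic_measure_pressure(1))
qed

lemma esssup_pressure_eq:
  "esssup ergodic_restriction (measure_pressure f \<phi>) =
   esssup ergodic_restriction (\<lambda>\<nu>. KS_entropy f \<nu> + ereal (\<integral>x. \<phi> x \<partial>\<nu>))"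
proof (rule esssup_AE_cong[OF measurable_pressure])
  show "(\<lambda>\<nu>. KS_entropy f \<nu> + ereal (\<integral>x. \<phi> x \<partial>\<nu>)) \<in> borel_measurable ergodic_restriction"
    using measurable_pressure
    by (subst measurable_cong) (simp_all add: space_restriction ergodic_measure_pressure(2)[symmetric])
  show "AE \<nu> in ergodic_restriction. measure_pressure f \<phi> \<nu> = KS_entropy f \<nu> + ereal (\<integral>x. \<phi> x \<partial>\<nu>)"
    by (rule AE_I2) (simp add: space_restriction ergodic_measure_pressure(2))
qed

text \<open>A set of full \<mu>-measure is full for almost every component and so competes in the
  infimum that defines the pressure of that component.\<close>

lemma esssup_le_measure_pressure:
  "esssup ergodic_restriction (measure_pressure f \<phi>) \<le> measure_pressure f \<phi> \<mu>"
proof (rule esssup_I[OF measurable_pressure])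
  have ae: "AE \<nu> in ergodic_restriction.
      measure_pressure_at f \<phi> \<nu> (1 / Suc j) \<le> measure_pressure_at f \<phi> \<mu> (1 / Suc j)" for j
  proof -
    let ?A = "{set_pressure_at f \<phi> Z (1 / Suc j) | Z. Z \<in> sets \<mu> \<and> emeasure \<mu> Z = 1}"
    have "UNIV \<in> sets \<mu>" "emeasure \<mu> UNIV = 1" using sets.top[of \<mu>] emeasure_space_1 by auto
    then have "?A \<noteq> {}" by blast
    \<comment> \<open>The exceptional null set depends on \<open>Z\<close>, so the infimum over all
      \<open>Z\<close> is first realised by a sequence.\<close>
    from Inf_countable_INF[OF this] obtain p :: "nat \<Rightarrow> ereal"
      where p: "range p \<subseteq> ?A" "Inf ?A = (INF i. p i)"
      by (elim exE conjE)
    have "AE \<nu> in ergodic_restriction. measure_pressure_at f \<phi> \<nu> (1 / Suc j) \<le> p i" for i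
    proof -
      obtain Z where Z: "p i = set_pressure_at f \<phi> Z (1 / Suc j)" "Z \<in> sets \<mu>" "emeasure \<mu> Z = 1"
        using p(1) by (auto simp: image_subset_iff)
      have "AE \<nu> in ergodic_restriction. emeasure \<nu> Z = 1"
        using Z(2,3) by (intro full_measure_iff[THEN iffD1]) (simp_all only: sets_M)
      moreover have "AE \<nu> in ergodic_restriction. sets \<nu> = sets borel"
      proof (rule AE_I2)
        fix \<nu> assume "\<nu> \<in> space ergodic_restriction"
        then have "\<nu> \<in> ergodic_measures f" by (simp only: space_restriction)
        then show "sets \<nu> = sets borel" by (simp add: ergodic_measures_def invariant_measures_def)
      qed
      ultimately show ?thesis
      proof eventually_elim
        fix \<nu> assume "emeasure \<nu> Z = 1" "sets \<nu> = sets borel"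
        then show "measure_pressure_at f \<phi> \<nu> (1 / Suc j) \<le> p i"
          unfolding Z(1) using Z(2) by (intro measure_pressure_at_le) (simp_all add: sets_M)
      qed
    qed
    then have "AE \<nu> in ergodic_restriction. \<forall>i. measure_pressure_at f \<phi> \<nu> (1 / Suc j) \<le> p i"
      by (simp add: AE_all_countable)
    then show ?thesis
      unfolding measure_pressure_at_def[of f \<phi> \<mu>] p(2)
      by eventually_elim (auto intro: INF_greatest)
  qed
  have "AE \<nu> in ergodic_restriction. \<forall>j.
      measure_pressure_at f \<phi> \<nu> (1 / Suc j) \<le> measure_pressure_at f \<phi> \<mu> (1 / Suc j)"
    using ae by (simp add: AE_all_countable)
  then show "AE \<nu> in ergodic_restriction. measure_pressure f \<phi> \<nu> \<le> measure_pressure f \<phi> \<mu>"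
  proof eventually_elim
    fix \<nu> assume *: "\<forall>j. measure_pressure_at f \<phi> \<nu> (1 / Suc j) \<le> measure_pressure_at f \<phi> \<mu> (1 / Suc j)"
    show "measure_pressure f \<phi> \<nu> \<le> measure_pressure f \<phi> \<mu>"
    proof (rule measure_pressure_leI)
      fix j
      have "measure_pressure_at f \<phi> \<mu> (1 / Suc j) \<le> measure_pressure f \<phi> \<mu>"
        unfolding measure_pressure_eq_SUP by (intro SUP_upper) simp
      then show "measure_pressure_at f \<phi> \<nu> (1 / Suc j) \<le> measure_pressure f \<phi> \<mu>"
        using * order_trans by blast
    qed
  qed
qed

lemma measure_pressure_le_esssup:
  "measure_pressure f \<phi> \<mu> \<le> esssup ergodic_restriction (measure_pressure f \<phi>)"
proof (rule ccontr)
  let ?s = "esssup ergodic_restriction (measure_pressure f \<phi>)"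
  assume "\<not> ?thesis"
  then have "?s < measure_pressure f \<phi> \<mu>" by (simp only: not_le)
  \<comment> \<open>Density supplies a real threshold even if one of the two sides is infinite, and
    the same \<open>t\<close> serves for every radius.\<close>
  from ereal_dense2[OF this] obtain t where t: "?s < ereal t" "ereal t < measure_pressure f \<phi> \<mu>"
    by (elim exE conjE)
  have "measure_pressure_at f \<phi> \<mu> (1 / Suc j) \<le> ereal t" for j
  proof (rule measure_pressure_at_le_threshold[OF invariant])
    have "AE \<nu> in ergodic_restriction. emeasure \<nu> (low_pressure_points f \<phi> (u j) (k j) t) = 1"
      using esssup_AE[of "measure_pressure f \<phi>" ergodic_restriction] AE_space
    proof eventually_elim
      fix \<nu> assume le: "measure_pressure f \<phi> \<nu> \<le> ?s" and "\<nu> \<in> space ergodic_restriction"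
      then have erg: "\<nu> \<in> ergodic_measures f" by (simp add: space_restriction)
      have "ereal (free_energy \<nu> j) \<le> measure_pressure f \<phi> \<nu>"
        unfolding ergodic_measure_pressure(1)[OF erg] by (rule SUP_upper) simp
      also have "\<dots> < ereal t" using le t(1) by (rule le_less_trans)
      finally show "emeasure \<nu> (low_pressure_points f \<phi> (u j) (k j) t) = 1"
        by (intro emeasure_low_pressure_points erg) simp
    qed
    then show "emeasure \<mu> (low_pressure_points f \<phi> (u j) (k j) t) = 1"
      using low_pressure_points_borel[OF invariant]
      by (intro full_measure_iff[THEN iffD2]) (simp_all only: sets_M)
  qed
  then have "measure_pressure f \<phi> \<mu> \<le> ereal t" by (rule measure_pressure_leI)
  then show False using t(2) by simp
qed

end

lemma small_labellings_exist:
  fixes f :: "'a::metric_space \<Rightarrow> 'a"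
  assumes "compact (UNIV :: 'a set)" "continuous_on UNIV f" "continuous_on UNIV \<phi>"
  obtains u k where "small_labellings f \<phi> u k"
proof -
  define good where "good j u k \<longleftrightarrow> u \<in> borel \<rightarrow>\<^sub>M count_space UNIV \<and> (\<forall>x. u x < k) \<and>
      (\<forall>x y. u x = u y \<longrightarrow> dist x y < 1 / real (Suc j))" for j :: nat and u :: "'a \<Rightarrow> nat" and k :: nat
  have "\<exists>u k. good j u k" for j
  proof -
    have "(0::real) < 1 / Suc j" by simp
    then obtain u :: "'a \<Rightarrow> nat" and k where "u \<in> borel \<rightarrow>\<^sub>M count_space UNIV" "\<And>x. u x < k"
      "\<And>x y. u x = u y \<Longrightarrow> dist x y < 1 / Suc j"
      using small_diameter_labelling[OF assms(1)] by blast
    then show ?thesis unfolding good_def by blast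
  qed
  then obtain u k where "\<And>j. good j (u j) (k j)" by metis
  then have "small_labellings f \<phi> u k"
    using assms unfolding good_def by unfold_locales auto
  then show thesis by (rule that)
qed

theorem theorem4p1:
  fixes f :: "'a::metric_space \<Rightarrow> 'a" and \<phi> :: "'a \<Rightarrow> real" and \<mu> :: "'a measure"
  assumes "compact (UNIV :: 'a set)"
    and "continuous_on UNIV f"
    and "continuous_on UNIV \<phi>"
    and "\<mu> \<in> invariant_measures f"
  shows "(\<forall>\<tau>. ergodic_decomposition f \<mu> \<tau> \<longrightarrow>
            measure_pressure f \<phi> \<mu> =
              esssup (restrict_space \<tau> (ergodic_measures f)) (\<lambda>\<nu>. measure_pressure f \<phi> \<nu>) \<and>
            esssup (restrict_space \<tau> (ergodic_measures f)) (\<lambda>\<nu>. measure_pressure f \<phi> \<nu>) =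
              esssup (restrict_space \<tau> (ergodic_measures f))
                (\<lambda>\<nu>. KS_entropy f \<nu> + ereal (integral\<^sup>L \<nu> \<phi>)))
         \<and> measure_pressure f \<phi> \<mu> \<ge> KS_entropy f \<mu> + ereal (integral\<^sup>L \<mu> \<phi>)"
proof (intro conjI allI impI)
  interpret invariant_system f \<mu> by unfold_locales (use assms in auto)
  obtain u k where small: "small_labellings f \<phi> u k"
    using small_labellings_exist[OF assms(1-3)] by blast
  show "KS_entropy f \<mu> + ereal (integral\<^sup>L \<mu> \<phi>) \<le> measure_pressure f \<phi> \<mu>"
    by (rule KS_entropy_le_measure_pressure[OF assms(1,3)])
  fix \<tau> assume dec: "ergodic_decomposition f \<mu> \<tau>"
  interpret decomposed_system f \<phi> u k \<mu> \<tau>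
    by (intro decomposed_system.intro decomposed_system_axioms.intro small invariant_system_axioms dec)
  show "measure_pressure f \<phi> \<mu> =
      esssup (restrict_space \<tau> (ergodic_measures f)) (\<lambda>\<nu>. measure_pressure f \<phi> \<nu>)"
    using measure_pressure_le_esssup esssup_le_measure_pressure by (rule antisym)
  show "esssup (restrict_space \<tau> (ergodic_measures f)) (\<lambda>\<nu>. measure_pressure f \<phi> \<nu>) =
      esssup (restrict_space \<tau> (ergodic_measures f)) (\<lambda>\<nu>. KS_entropy f \<nu> + ereal (integral\<^sup>L \<nu> \<phi>))"
    by (rule esssup_pressure_eq)
qed

end
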